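(* Let $G$ be an abelian group and let $\Gamma\colon\mathcal{A}=\bigoplus_{g\in G}\mathcal{A}_g$ be a $G$-grading on $(\mathcal{A},-)$ which is not compatible with $\Gamma^i_S$ for any $i\in\{1,2,3\}$. Then $\Gamma$ is isomorphic either to $\Gamma(G,g_1,g_2)$ for some $g_1,g_2\in G$ of order $3$ with $g_1\neq g_2\neq (g_1g_2)^{-1}$, or to $\Gamma(G,h,g)$ for some $h\in G$ of order $2$ and $g\in G$ of order $3$.
   Context: $\mathbb{F}$ is an algebraically closed field of characteristic different from $2,3,5$. Let $\mathcal{B}=\mathbb{F}\oplus\mathbb{F}\oplus\mathbb{F}\oplus\mathbb{F}$ with componentwise product, $t$ its trace (sum of the four coordinates), and $b^\theta=-b+\tfrac12 t(b)1$ for $b\in\mathcal{B}$. The split quartic Cayley algebra is the (nonassociative, unital) algebra with involution $\mathcal{A}=\mathcal{B}\oplus s\mathcal{B}=\{b_1+sb_2\mid b_1,b_2\in\mathcal{B}\}$, with product and involution $$(b_1+sb_2)(b_3+sb_4)=\big(b_1b_3+(b_2b_4^\theta)^\theta\big)+s\big(b_1^\theta b_4+(b_2^\theta b_3^\theta)^\theta\big),\qquad \overline{b_1+sb_2}=b_1-sb_2^\theta .$$ Write $s=s1$, $x_1=(1,1,-1,-1)$, $x_2=(1,-1,1,-1)$, $x_3=(1,-1,-1,1)\in\mathcal{B}$, $\mathcal{K}=\mathbb{F}1\oplus\mathbb{F}s$ (a subalgebra with $s^2=1$), $e_+=\tfrac12(1+s)$, $e_-=\tfrac12(1-s)$; $rx$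 (for $r\in\mathcal{K}$) is the product in $\mathcal{A}$, and $\mathcal{A}=\mathcal{K}\oplus\mathcal{K}x_1\oplus\mathcal{K}x_2\oplus\mathcal{K}x_3$. For an abelian group $G$ with neutral element $e$, a $G$-grading on $(\mathcal{A},-)$ is a decomposition $\mathcal{A}=\bigoplus_{g\in G}\mathcal{A}_g$ into subspaces with $\mathcal{A}_g\mathcal{A}_h\subseteq\mathcal{A}_{gh}$ and $\overline{\mathcal{A}_g}\subseteq\mathcal{A}_g$; $\deg(x)=g$ means $x\in\mathcal{A}_g$. Two $G$-gradings on $(\mathcal{A},-)$, with components $\mathcal{A}_g$ and $\mathcal{A}'_g$, are isomorphic if there is an algebra automorphism $\varphi$ of $\mathcal{A}$ commuting with the involution with $\varphi(\mathcal{A}_g)=\mathcal{A}'_g$ for all $g\in G$. A $G$-grading $\mathcal{A}=\bigoplus_{g\in G}\mathcal{A}_g$ and an $H$-grading $\mathcal{A}=\bigoplus_{h\in H}\mathcal{A}'_h$ are compatible if $\mathcal{A}=\bigoplus_{(g,h)\in G\times H}\mathcal{A}_g\cap\mathcal{A}'_h$. For $\{i,j,k\}=\{1,2,3\}$, $\Gamma^i_S$ is the $\mathbb{Z}_2$-grading with $\mathcal{A}_{\bar0}=\mathcal{K}\oplus\mathcal{K}x_i$ and $\mathcal{A}_{\bar1}=\mathcal{K}x_j\oplus\mathcal{K}x_k$. Fix a primitive cubic root of unity $\zeta\in\mathbb{F}$. The $G$-gradings in the claim are determined by the following degrees (with $\deg(1)=e$): $\Gamma(G,g_1,g_2)$ (for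 $g_1,g_2$ of order $3$ with $g_1\neq g_2\neq(g_1g_2)^{-1}$): $\deg(s)=e$, $\deg(e_+(x_1+\zeta x_2+\zeta^2x_3))=g_1$, $\deg(e_+(x_1+\zeta^2x_2+\zeta x_3))=g_2$, $\deg(e_+(x_1+x_2+x_3))=(g_1g_2)^{-1}$ (hence, by squaring these elements, $\deg(e_-(x_1+\zeta^2x_2+\zeta x_3))=g_1^{-1}$, $\deg(e_-(x_1+\zeta x_2+\zeta^2x_3))=g_2^{-1}$, $\deg(e_-(x_1+x_2+x_3))=g_1g_2$). $\Gamma(G,h,g)$ (for $h$ of order $2$ and $g$ of order $3$): $\deg(s)=h$, $\deg(x_1+\zeta x_2+\zeta^2x_3)=g$ (hence $\deg(x_1+\zeta^2x_2+\zeta x_3)=g^2$, $\deg(x_1+x_2+x_3)=e$, and multiplication by $s$ on the left shifts degrees by $h$). *)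

theory Defs
  imports "HOL-Analysis.Analysis" "HOL-Algebra.Elementary_Groups" "HOL-Algebra.Multiplicative_Group"
begin

section \<open>The split quartic Cayley algebra\<close>

text \<open>
  The library's product on \<open>'a ^ 4\<close> is the componentwise one, with unit \<open>(1,1,1,1)\<close>.
  The pair \<open>(b\<^sub>1, b\<^sub>2)\<close> stands for \<open>b\<^sub>1 + s b\<^sub>2\<close>.
\<close>

type_synonym 'a quartic = "'a ^ 4"
type_synonym 'a qcayley = "'a quartic \<times> 'a quartic"

definition trace4 :: "'a::field quartic \<Rightarrow> 'a" where
  "trace4 b = (\<Sum>i\<in>UNIV. b $ i)"

definition theta :: "'a::field quartic \<Rightarrow> 'a quartic" where
  "theta b = - b + (1 / 2 * trace4 b) *s 1"

fun qmult :: "'a::field qcayley \<Rightarrow> 'a qcayley \<Rightarrow> 'a qcayley"  (infixl "\<star>" 70) where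
  "(b1, b2) \<star> (b3, b4) =
     (b1 * b3 + theta (b2 * theta b4), theta b1 * b4 + theta (theta b2 * theta b3))"

fun qinvol :: "'a::field qcayley \<Rightarrow> 'a qcayley" where
  "qinvol (b1, b2) = (b1, - theta b2)"

fun qscale :: "'a::field \<Rightarrow> 'a qcayley \<Rightarrow> 'a qcayley"  (infixr "*q" 75) where
  "c *q (b1, b2) = (c *s b1, c *s b2)"

interpretation qc: vector_space "qscale :: 'a::field \<Rightarrow> 'a qcayley \<Rightarrow> 'a qcayley"
  by unfold_locales (auto simp: vec_eq_iff algebra_simps)

definition q1 :: "'a::field qcayley" where "q1 = (1, 0)"

definition qs :: "'a::field qcayley" where "qs = (0, 1)"

definition e_plus :: "'a::field qcayley" where "e_plus = (1 / 2) *q (q1 + qs)"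

definition e_minus :: "'a::field qcayley" where "e_minus = (1 / 2) *q (q1 - qs)"

text \<open>\<open>qx i\<close> is \<open>x\<^sub>i\<close>; it is only used for \<open>i \<in> {1, 2, 3}\<close>.\<close>

definition qx :: "nat \<Rightarrow> 'a::field qcayley" where
  "qx i = (if i = 1 then vector [1, 1, -1, -1]
           else if i = 2 then vector [1, -1, 1, -1]
           else vector [1, -1, -1, 1], 0)"

definition xcomb :: "'a::field \<Rightarrow> 'a \<Rightarrow> 'a \<Rightarrow> 'a qcayley" where
  "xcomb a b c = a *q qx 1 + b *q qx 2 + c *q qx 3"

definition qK :: "'a::field qcayley set" where
  "qK = qc.span {q1, qs}"


section \<open>Gradings\<close>

text \<open>
  Every element is a finite sum of components in exactly one way. The values of the family
  \<open>V\<close> outside the index set \<open>I\<close> are irrelevant.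
\<close>

definition is_direct_sum :: "'i set \<Rightarrow> ('i \<Rightarrow> 'a::field qcayley set) \<Rightarrow> bool" where
  "is_direct_sum I V \<longleftrightarrow>
     (\<forall>i\<in>I. qc.subspace (V i)) \<and>
     (\<forall>x. \<exists>!f. (\<forall>i\<in>I. f i \<in> V i) \<and> (\<forall>i. i \<notin> I \<longrightarrow> f i = 0) \<and>
               finite {i. f i \<noteq> 0} \<and> x = (\<Sum>i | f i \<noteq> 0. f i))"

definition is_grading :: "('g, 'm) monoid_scheme \<Rightarrow> ('g \<Rightarrow> 'a::field qcayley set) \<Rightarrow> bool" where
  "is_grading G A \<longleftrightarrow>
     is_direct_sum (carrier G) A \<and>
     (\<forall>g\<in>carrier G. \<forall>h\<in>carrier G. \<forall>x\<in>A g. \<forall>y\<in>A h. x \<star> y \<in> A (g \<otimes>\<^bsub>G\<^esub> h)) \<and>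
     (\<forall>g\<in>carrier G. qinvol ` A g \<subseteq> A g)"

definition is_automorphism :: "('a::field qcayley \<Rightarrow> 'a qcayley) \<Rightarrow> bool" where
  "is_automorphism \<phi> \<longleftrightarrow>
     Vector_Spaces.linear qscale qscale \<phi> \<and> bij \<phi> \<and>
     (\<forall>x y. \<phi> (x \<star> y) = \<phi> x \<star> \<phi> y) \<and> (\<forall>x. \<phi> (qinvol x) = qinvol (\<phi> x))"

definition isomorphic_gradings ::
  "('g, 'm) monoid_scheme \<Rightarrow> ('g \<Rightarrow> 'a::field qcayley set) \<Rightarrow> ('g \<Rightarrow> 'a qcayley set) \<Rightarrow> bool" where
  "isomorphic_gradings G A A' \<longleftrightarrow>
     (\<exists>\<phi>. is_automorphism \<phi> \<and> (\<forall>g\<in>carrier G. \<phi> ` A g = A' g))"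

definition compatible_gradings ::
  "('g, 'm) monoid_scheme \<Rightarrow> ('h, 'n) monoid_scheme \<Rightarrow>
   ('g \<Rightarrow> 'a::field qcayley set) \<Rightarrow> ('h \<Rightarrow> 'a qcayley set) \<Rightarrow> bool" where
  "compatible_gradings G H A A' \<longleftrightarrow>
     is_direct_sum (carrier G \<times> carrier H) (\<lambda>(g, h). A g \<inter> A' h)"

text \<open>
  The grading \<open>\<Gamma>\<^sub>S\<^sup>i\<close> by \<open>integer_mod_group 2\<close>, whose carrier is \<open>{0, 1}\<close>.
\<close>

definition GammaS :: "nat \<Rightarrow> int \<Rightarrow> 'a::field qcayley set" where
  "GammaS i d =
     (if d = 0 then {r + r' \<star> qx i | r r'. r \<in> qK \<and> r' \<in> qK}
      else {\<Sum>j\<in>{1, 2, 3} - {i}. r j \<star> qx j | r. \<forall>j. r j \<in> qK})"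

definition primitive_root_of_unity :: "nat \<Rightarrow> 'a::field \<Rightarrow> bool" where
  "primitive_root_of_unity n z \<longleftrightarrow> n > 0 \<and> z ^ n = 1 \<and> (\<forall>k. 0 < k \<and> k < n \<longrightarrow> z ^ k \<noteq> 1)"

text \<open>
  A grading is given by a set of pairs consisting of a homogeneous basis element and its degree;
  the component of degree \<open>g\<close> is the span of the basis elements of degree \<open>g\<close>.
  Different basis elements may have the same degree.
\<close>

definition graded_by_basis :: "('a::field qcayley \<times> 'g) set \<Rightarrow> 'g \<Rightarrow> 'a qcayley set" where
  "graded_by_basis D g = qc.span {x. (x, g) \<in> D}"

definition Gamma33 ::
  "('g, 'm) monoid_scheme \<Rightarrow> 'a::field \<Rightarrow> 'g \<Rightarrow> 'g \<Rightarrow> 'g \<Rightarrow> 'a qcayley set" where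
  "Gamma33 G \<zeta> g1 g2 = graded_by_basis
     {(q1, \<one>\<^bsub>G\<^esub>), (qs, \<one>\<^bsub>G\<^esub>),
      (e_plus \<star> xcomb 1 \<zeta> (\<zeta>^2), g1),
      (e_plus \<star> xcomb 1 (\<zeta>^2) \<zeta>, g2),
      (e_plus \<star> xcomb 1 1 1, inv\<^bsub>G\<^esub> (g1 \<otimes>\<^bsub>G\<^esub> g2)),
      (e_minus \<star> xcomb 1 (\<zeta>^2) \<zeta>, inv\<^bsub>G\<^esub> g1),
      (e_minus \<star> xcomb 1 \<zeta> (\<zeta>^2), inv\<^bsub>G\<^esub> g2),
      (e_minus \<star> xcomb 1 1 1, g1 \<otimes>\<^bsub>G\<^esub> g2)}"

definition Gamma23 ::
  "('g, 'm) monoid_scheme \<Rightarrow> 'a::field \<Rightarrow> 'g \<Rightarrow> 'g \<Rightarrow> 'g \<Rightarrow> 'a qcayley set" where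
  "Gamma23 G \<zeta> h g = graded_by_basis
     {(q1, \<one>\<^bsub>G\<^esub>), (qs, h),
      (xcomb 1 \<zeta> (\<zeta>^2), g),
      (xcomb 1 (\<zeta>^2) \<zeta>, g [^]\<^bsub>G\<^esub> (2::nat)),
      (xcomb 1 1 1, \<one>\<^bsub>G\<^esub>),
      (qs \<star> xcomb 1 \<zeta> (\<zeta>^2), h \<otimes>\<^bsub>G\<^esub> g),
      (qs \<star> xcomb 1 (\<zeta>^2) \<zeta>, h \<otimes>\<^bsub>G\<^esub> g [^]\<^bsub>G\<^esub> (2::nat)),
      (qs \<star> xcomb 1 1 1, h)}"

end

theory Submission
  imports Defs
begin

text \<open>
  Put \<open>u\<^sub>i = e\<^sub>+ x\<^sub>i\<close> and \<open>v\<^sub>i = e\<^sub>- x\<^sub>i\<close>. In the basis \<open>e\<^sub>+, e\<^sub>-, u\<^sub>i, v\<^sub>i\<close> the algebra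
  consists of \<open>2 \<times> 2\<close> matrices with scalars \<open>p, q\<close> on the diagonal and vectors \<open>a, b\<close> of
  \<open>F\<^sup>3\<close> off it. The product (\<open>smat_mult\<close>) uses the dot product and the symmetric bilinear map
  \<open>a \<times> b\<close> with \<open>a \<times> a = 2 (a\<^sub>2 a\<^sub>3, a\<^sub>1 a\<^sub>3, a\<^sub>1 a\<^sub>2)\<close>, the gradient of the norm \<open>a\<^sub>1 a\<^sub>2 a\<^sub>3\<close> up to the factor 2.
  The involution exchanges \<open>p\<close> and \<open>q\<close>. Its skew elements form the line through \<open>s\<close>, so \<open>s\<close> is
  homogeneous, of a degree \<open>h\<close> with \<open>h\<^sup>2 = e\<close>, and both \<open>K\<close> and the span \<open>W\<close> of all \<open>u\<^sub>i, v\<^sub>i\<close>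
  are graded.

  The key observation is that the algebra \<open>F\<^sup>3\<close> of diagonal operators on \<open>W = K x\<^sub>1 + K x\<^sub>2 + K x\<^sub>3\<close>
  inherits a grading. For \<open>w = (a, b)\<close> and \<open>w' = (c, d)\<close> homogeneous in \<open>W\<close>, a fixed expression in
  products by \<open>w\<close> and \<open>w'\<close> is the diagonal operator \<open>a d + b c\<close> (\<open>hdiag_polar\<close>), and the trace of
  \<open>a d + b c\<close> is zero unless the degrees of \<open>w\<close> and \<open>w'\<close> cancel (\<open>degree_of_trace\<close>). If the part of
  degree \<open>e\<close> of \<open>F\<^sup>3\<close> is not just the scalars, then it contains the idempotent of some coordinate
  \<open>i\<close>, and the grading is compatible with \<open>\<Gamma>\<^sub>S\<^sup>i\<close> (\<open>compatible_GammaS\<close>). Otherwise all elements of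
  degree different from \<open>e\<close> have trace zero. Take one such \<open>t \<noteq> 0\<close>, of degree \<open>f\<close>. If \<open>f\<^sup>3 \<noteq> e\<close>,
  then \<open>t\<close> and \<open>t\<^sup>3\<close> have trace zero, so a coordinate of \<open>t\<close> vanishes and \<open>t\<^sup>2\<close> is proportional to
  an idempotent other than 0 and 1, which is then of degree \<open>e\<close>: a contradiction. Hence \<open>f\<^sup>3 = e\<close>,
  both \<open>t\<close> and \<open>t\<^sup>2\<close> have trace zero, and the coordinates of \<open>t\<close> are proportional to the three cube
  roots of unity. So \<open>D = diag(1, \<zeta>, \<zeta>\<^sup>2)\<close> may be assumed to be homogeneous of degree \<open>f\<close>
  (\<open>hdiag_omega\<close>).

  If \<open>h = e\<close>, the span of the \<open>u\<^sub>i\<close> is graded. Take \<open>w \<noteq> 0\<close> homogeneous in it. As \<open>w\<close>, \<open>D w\<close> and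
  \<open>D\<^sup>2 w\<close> have different degrees, they are independent, so all coordinates of \<open>w\<close> are nonzero. After
  scaling \<open>w\<close> to norm 1, an automorphism of the torus takes it to \<open>u\<^sub>1 + u\<^sub>2 + u\<^sub>3\<close>, and the whole
  grading is determined by \<open>D\<close> and by the degree of \<open>w\<close>, whose cube is \<open>e\<close> since the norm of \<open>w\<close> is
  nonzero. This gives \<open>\<Gamma>(G, g\<^sub>1, g\<^sub>2)\<close> (\<open>Gamma33_case\<close>).

  If \<open>h \<noteq> e\<close>, the six elements \<open>D\<^sup>j w\<close> and \<open>s D\<^sup>j w\<close> have different degrees, and again no coordinate of
  \<open>w\<close> vanishes. Traces and the norm show that the degree of \<open>w\<close> lies in the subgroup generated by
  \<open>f\<close> and \<open>h\<close>, so that \<open>w\<close> can be taken of degree \<open>e\<close>. The part of \<open>W\<close> of degree \<open>e\<close> is then the line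
  through \<open>w\<close>, whence the \<open>W\<close>-part of \<open>w w\<close> is a multiple of \<open>w\<close>. With the right scaling this equation
  says that \<open>w\<close> is in the torus orbit of \<open>x\<^sub>1 + x\<^sub>2 + x\<^sub>3\<close>, which gives \<open>\<Gamma>(G, h, f)\<close> (\<open>Gamma23_case\<close>).
\<close>

section \<open>Matrix coordinates\<close>

text \<open>
  \<open>c\<^sub>0 1 + c\<^sub>1 x\<^sub>1 + c\<^sub>2 x\<^sub>2 + c\<^sub>3 x\<^sub>3\<close>.
\<close>

definition quart :: "'a::field \<Rightarrow> 'a ^ 3 \<Rightarrow> 'a quartic" where
  "quart c0 c = vector [c0 + c $ 1 + c $ 2 + c $ 3, c0 + c $ 1 - c $ 2 - c $ 3,
                        c0 - c $ 1 + c $ 2 - c $ 3, c0 - c $ 1 - c $ 2 + c $ 3]"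

definition scross :: "'a::field ^ 3 \<Rightarrow> 'a ^ 3 \<Rightarrow> 'a ^ 3" where
  "scross a b = vector [a $ 2 * b $ 3 + a $ 3 * b $ 2,
                        a $ 1 * b $ 3 + a $ 3 * b $ 1,
                        a $ 1 * b $ 2 + a $ 2 * b $ 1]"

definition tr3 :: "'a::field ^ 3 \<Rightarrow> 'a" where
  "tr3 a = a $ 1 + a $ 2 + a $ 3"

text \<open>
  The matrix with diagonal \<open>p, q\<close> and off-diagonal entries \<open>a, b\<close>: the element
  \<open>p e\<^sub>+ + q e\<^sub>- + \<Sum> a\<^sub>i e\<^sub>+ x\<^sub>i + \<Sum> b\<^sub>i e\<^sub>- x\<^sub>i\<close>.
\<close>

definition smat :: "'a::field \<Rightarrow> 'a \<Rightarrow> 'a ^ 3 \<Rightarrow> 'a ^ 3 \<Rightarrow> 'a qcayley" where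
  "smat p q a b = (quart ((p + q) / 2) ((1 / 2) *s (a + b)), quart ((p - q) / 2) ((1 / 2) *s (a - b)))"

text \<open>
  Since \<open>1, x\<^sub>1, x\<^sub>2, x\<^sub>3\<close> are orthogonal of square length 4, these are the traces \<open>t(b x\<^sub>i)\<close>, four times
  the coefficients of the \<open>x\<^sub>i\<close> in \<open>b\<close>.
\<close>

definition ctr :: "'a::field quartic \<Rightarrow> 'a ^ 3" where
  "ctr b = vector [b $ 1 + b $ 2 - b $ 3 - b $ 4, b $ 1 - b $ 2 + b $ 3 - b $ 4, b $ 1 - b $ 2 - b $ 3 + b $ 4]"

lemma vector4_nth [simp]:
  "(vector [x, y, z, w] :: 'a::zero ^ 4) $ 1 = x"
  "(vector [x, y, z, w] :: 'a::zero ^ 4) $ 2 = y"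
  "(vector [x, y, z, w] :: 'a::zero ^ 4) $ 3 = z"
  "(vector [x, y, z, w] :: 'a::zero ^ 4) $ 4 = w"
  by (simp_all add: vector_def)

lemma vec3_eq_iff: "(x :: 'b ^ 3) = y \<longleftrightarrow> x $ 1 = y $ 1 \<and> x $ 2 = y $ 2 \<and> x $ 3 = y $ 3"
  by (simp add: vec_eq_iff forall_3)

lemma vec4_eq_iff: "(x :: 'b ^ 4) = y \<longleftrightarrow> x $ 1 = y $ 1 \<and> x $ 2 = y $ 2 \<and> x $ 3 = y $ 3 \<and> x $ 4 = y $ 4"
  by (simp add: vec_eq_iff forall_4)

lemma quart_add: "quart c0 c + quart d0 d = quart (c0 + d0) (c + d)"
  by (simp add: quart_def vec4_eq_iff)

lemma quart_uminus: "- quart c0 c = quart (- c0) (- c)"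
  by (simp add: quart_def vec4_eq_iff)

lemma quart_scale: "k *s quart c0 c = quart (k * c0) (k *s c)"
  by (simp add: quart_def vec4_eq_iff algebra_simps)

lemma scross_nth [simp]:
  "scross a b $ 1 = a $ 2 * b $ 3 + a $ 3 * b $ 2"
  "scross a b $ 2 = a $ 1 * b $ 3 + a $ 3 * b $ 1"
  "scross a b $ 3 = a $ 1 * b $ 2 + a $ 2 * b $ 1"
  by (simp_all add: scross_def)

lemma scross_zero [simp]: "scross 0 a = 0" "scross a 0 = 0"
  by (simp_all add: vec3_eq_iff)

text \<open>
  The elements \<open>1, x\<^sub>1, x\<^sub>2, x\<^sub>3\<close> multiply like a Klein four-group.
\<close>

lemma quart_mult:
  "quart c0 c * quart d0 d = quart (c0 * d0 + tr3 (c * d)) (c0 *s d + d0 *s c + scross c d)"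
  by (simp add: quart_def vec4_eq_iff tr3_def algebra_simps)

lemma arg_cong4: "x = x' \<Longrightarrow> y = y' \<Longrightarrow> z = z' \<Longrightarrow> w = w' \<Longrightarrow> f x y z w = f x' y' z' w'"
  by simp

text \<open>The type parameter only names the field, so that the hypothesis on it can be shared.\<close>

locale char_not_two =
  fixes ty :: "'a::field itself"
  assumes two_nz [simp]: "(2::'a) \<noteq> 0"
begin

lemma four_nz [simp]: "(4::'a) \<noteq> 0"
proof -
  have "(4::'a) = 2 * 2" by simp
  then show ?thesis by (simp only: mult_eq_0_iff two_nz) simp
qed

lemma theta_quart: "theta (quart (c0::'a) c) = quart c0 (- c)"
proof -
  have "trace4 (quart c0 c) = 4 * c0"
    by (simp add: trace4_def sum_4 quart_def)
  then have "1 / 2 * trace4 (quart c0 c) = 2 * c0" by simp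
  then show ?thesis
    by (simp add: theta_def quart_def vec4_eq_iff)
qed

text \<open>
  Half sums and half differences disappear when matrix entries are written as sums and differences of
  the coefficients in \<open>B \<oplus> s B\<close>; products are therefore computed on this side.
\<close>

lemma smat_quart: "smat (c0 + d0) (c0 - d0) (c + d) (c - d) = (quart c0 c, quart (d0::'a) d)"
  by (simp add: smat_def vec3_eq_iff quart_def)

lemma smat_quart_exhaust:
  fixes p q :: 'a and a b :: "'a ^ 3"
  obtains c0 d0 :: 'a and c d where "p = c0 + d0" "q = c0 - d0" "a = c + d" "b = c - d"
proof
  show "p = (p + q) / 2 + (p - q) / 2" "q = (p + q) / 2 - (p - q) / 2"
    by (simp_all add: add_divide_distrib diff_divide_distrib)
  show "a = (1 / 2) *s (a + b) + (1 / 2) *s (a - b)" "b = (1 / 2) *s (a + b) - (1 / 2) *s (a - b)"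
    by (simp_all add: vec3_eq_iff add_divide_distrib diff_divide_distrib)
qed

text \<open>
  The multiplication table comes from \<open>(r x\<^sub>i) (r' x\<^sub>j) = (r\<^sup>* r'\<^sup>*) x\<^sub>k\<close> and \<open>(r x\<^sub>i) (r' x\<^sub>i) = r r'\<^sup>*\<close> for
  \<open>r, r' \<in> K\<close>, where \<open>*\<close> exchanges \<open>e\<^sub>+\<close> and \<open>e\<^sub>-\<close>.
\<close>

lemma smat_mult:
  "smat p q a b \<star> smat p' q' a' b' =
   smat (p * p' + tr3 (a * b')) (q * (q'::'a) + tr3 (b * a'))
        (p *s a' + q' *s a + scross b b') (q *s b' + p' *s b + scross a a')"
proof -
  obtain c0 d0 c d where 1: "p = c0 + d0" "q = c0 - d0" "a = c + d" "b = c - d"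
    by (rule smat_quart_exhaust)
  obtain c0' d0' c' d' where 2: "p' = c0' + d0'" "q' = c0' - d0'" "a' = c' + d'" "b' = c' - d'"
    by (rule smat_quart_exhaust)
  have "smat p q a b \<star> smat p' q' a' b' = (quart c0 c, quart d0 d) \<star> (quart c0' c', quart d0' d')"
    by (simp only: 1 2 smat_quart)
  also have "\<dots> = (quart (c0 * c0' + tr3 (c * c') + d0 * d0' + tr3 (d * - d'))
       (c0 *s c' + c0' *s c + scross c c' + - (d0 *s - d' + d0' *s d + scross d (- d'))),
     quart (c0 * d0' + tr3 (- c * d') + d0 * c0' + tr3 (- d * - c'))
       (c0 *s d' + d0' *s - c + scross (- c) d' + - (d0 *s - c' + c0' *s - d + scross (- d) (- c'))))"
    by (simp only: qmult.simps theta_quart quart_mult quart_add add.assoc)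
  also have "\<dots> = smat (p * p' + tr3 (a * b')) (q * (q'::'a) + tr3 (b * a'))
        (p *s a' + q' *s a + scross b b') (q *s b' + p' *s b + scross a a')"
    unfolding smat_quart [symmetric] 1 2
    by (intro arg_cong4[of _ _ _ _ _ _ _ _ smat]; simp add: vec3_eq_iff tr3_def algebra_simps)
  finally show ?thesis .
qed

lemma smat_invol: "qinvol (smat p q a b) = smat q (p::'a) a b"
proof -
  obtain c0 d0 c d where 1: "p = c0 + d0" "q = c0 - d0" "a = c + d" "b = c - d"
    by (rule smat_quart_exhaust)
  show ?thesis unfolding 1 smat_quart
    using smat_quart[of c0 "- d0" c d] by (simp add: theta_quart quart_uminus)
qed

lemma smat_add: "smat p q a b + smat p' q' a' b' = smat (p + p') (q + q') (a + a') (b + (b' :: 'a ^ 3))"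
  by (simp add: smat_def quart_add add_divide_distrib diff_divide_distrib algebra_simps vec3_eq_iff)

lemma smat_scale: "k *q smat p q a b = smat (k * p) (k * q) (k *s a) (k *s (b :: 'a ^ 3))"
  by (simp add: smat_def quart_scale vec3_eq_iff algebra_simps add_divide_distrib diff_divide_distrib)

lemma smat_surj: "\<exists>p q a b. x = smat p q a (b :: 'a ^ 3)"
proof -
  obtain y z where x: "x = (y, z)" by (cases x)
  have q: "y = quart ((1 / 4) * trace4 y) ((1 / 4) *s ctr y)" for y :: "'a quartic"
  proof -
    have "y = (1 / 4) *s (4 *s y)" by (simp add: vec4_eq_iff)
    also have "4 *s y = quart (trace4 y) (ctr y)"
      by (simp add: quart_def vec4_eq_iff ctr_def trace4_def sum_4)
    finally show ?thesis by (simp only: quart_scale)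
  qed
  obtain c0 c d0 d where "y = quart c0 c" "z = quart d0 d" using q[of y] q[of z] by blast
  then have "x = smat (c0 + d0) (c0 - d0) (c + d) (c - d)"
    by (simp add: x smat_quart)
  then show ?thesis by blast
qed

definition mp :: "'a qcayley \<Rightarrow> 'a" where "mp x = (trace4 (fst x) + trace4 (snd x)) / 4"
definition mq :: "'a qcayley \<Rightarrow> 'a" where "mq x = (trace4 (fst x) - trace4 (snd x)) / 4"
definition ma :: "'a qcayley \<Rightarrow> 'a ^ 3" where "ma x = (1 / 4) *s (ctr (fst x) + ctr (snd x))"
definition mb :: "'a qcayley \<Rightarrow> 'a ^ 3" where "mb x = (1 / 4) *s (ctr (fst x) - ctr (snd x))"

lemma trace4_quart: "trace4 (quart c0 c) = 4 * (c0 :: 'a)" and ctr_quart: "ctr (quart c0 c) = (4 :: 'a) *s c"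
  by (simp_all add: trace4_def sum_4 quart_def ctr_def vec3_eq_iff)

lemma smat_sel [simp]:
  "mp (smat p q a b) = p" "mq (smat p q a b) = q" "ma (smat p q a b) = a" "mb (smat p q a b) = b"
proof -
  obtain c0 d0 c d where 1: "p = c0 + d0" "q = c0 - d0" "a = c + d" "b = c - d"
    by (rule smat_quart_exhaust)
  show "mp (smat p q a b) = p" "mq (smat p q a b) = q" "ma (smat p q a b) = a" "mb (smat p q a b) = b"
    unfolding 1 smat_quart mp_def mq_def ma_def mb_def
    by (simp_all add: trace4_quart ctr_quart add_divide_distrib diff_divide_distrib vec3_eq_iff)
qed

lemma smat_inj: "smat p q a b = smat p' q' a' (b' :: 'a ^ 3) \<longleftrightarrow> p = p' \<and> q = q' \<and> a = a' \<and> b = b'"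
  by (metis smat_sel)

lemma smat_cases:
  obtains p q a b where "(x :: 'a qcayley) = smat p q a b"
  using smat_surj[of x] by blast

lemma quart_one: "quart (1::'a) 0 = 1" and quart_zero: "quart (0::'a) 0 = 0"
  by (simp_all add: quart_def vec4_eq_iff)

lemma q1_smat: "(q1 :: 'a qcayley) = smat 1 1 0 0"
  using smat_quart[of 1 0 0 0] by (simp add: q1_def quart_one quart_zero)

lemma qs_smat: "(qs :: 'a qcayley) = smat 1 (-1) 0 0"
  using smat_quart[of 0 1 0 0] by (simp add: qs_def quart_one quart_zero)

lemma zero_smat: "(0 :: 'a qcayley) = smat 0 0 0 0"
  using smat_quart[of 0 0 0 0] by (simp add: zero_prod_def quart_zero)

lemma smat_diagonal: "smat 0 0 a a = (quart (0::'a) a, 0)"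
  using smat_quart[of 0 0 a 0] by (simp add: quart_zero)

lemma qx_smat:
  "qx i = (let v = (if i = 1 then vector [1, 0, 0] else if i = 2 then vector [0, 1, 0]
                    else vector [0, 0, 1]) in smat (0::'a) 0 v v)"
  by (simp add: qx_def smat_diagonal Let_def quart_def vec4_eq_iff)

lemma xcomb_smat: "xcomb (x::'a) y z = smat 0 0 (vector [x, y, z]) (vector [x, y, z])"
  by (simp add: xcomb_def qx_smat Let_def smat_scale smat_add smat_inj vec3_eq_iff)

lemma e_plus_smat: "(e_plus :: 'a qcayley) = smat 1 0 0 0"
  by (simp add: e_plus_def q1_smat qs_smat smat_add smat_scale)

lemma smat_diff: "smat p q a b - smat p' q' a' b' = smat (p - p') (q - q') (a - a') (b - (b' :: 'a ^ 3))"
  by (simp add: diff_eq_eq smat_add)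

lemma e_minus_smat: "(e_minus :: 'a qcayley) = smat 0 1 0 0"
  by (simp add: e_minus_def q1_smat qs_smat smat_diff smat_scale)

end

section \<open>Direct sums and homogeneous maps\<close>

text \<open>Elements of the algebra are treated as atomic from here on.\<close>

declare split_paired_All [simp del] split_paired_Ex [simp del]

abbreviation qlinear :: "('a::field qcayley \<Rightarrow> 'a qcayley) \<Rightarrow> bool" where
  "qlinear \<equiv> Vector_Spaces.linear qscale qscale"

lemma qlinear_iff:
  "qlinear L \<longleftrightarrow> (\<forall>x y. L (x + y) = L x + L y) \<and> (\<forall>c x. L (c *q x) = c *q L x)"
  by (simp add: Vector_Spaces.linear_iff qc.vector_space_axioms)

lemma qlinear_add: "qlinear L \<Longrightarrow> L (x + y) = L x + L y"
  and qlinear_scale: "qlinear L \<Longrightarrow> L (c *q x) = c *q L x"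
  by (simp_all add: qlinear_iff)

lemma qlinear_0: "qlinear L \<Longrightarrow> L 0 = 0"
  using qlinear_add[of L 0 0] by simp

lemma qlinear_diff: "qlinear L \<Longrightarrow> L (x - y) = L x - L y"
  using qlinear_add[of L "x - y" y] by (simp add: eq_diff_eq)

lemma qlinear_sum: "qlinear L \<Longrightarrow> L (sum f S) = (\<Sum>i\<in>S. L (f i))"
  by (induction S rule: infinite_finite_induct) (simp_all add: qlinear_0 qlinear_add)

lemma qlinear_compose: "qlinear L \<Longrightarrow> qlinear L' \<Longrightarrow> qlinear (\<lambda>x. L (L' x))"
  by (simp add: qlinear_iff)

definition decomposition ::
  "'i set \<Rightarrow> ('i \<Rightarrow> 'a::field qcayley set) \<Rightarrow> 'a qcayley \<Rightarrow> ('i \<Rightarrow> 'a qcayley) \<Rightarrow> bool" where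
  "decomposition I V x f \<longleftrightarrow> (\<forall>i\<in>I. f i \<in> V i) \<and> (\<forall>i. i \<notin> I \<longrightarrow> f i = 0) \<and>
     finite {i. f i \<noteq> 0} \<and> (\<Sum>i | f i \<noteq> 0. f i) = x"

lemma is_direct_sum_decomposition:
  "is_direct_sum I V \<longleftrightarrow> (\<forall>i\<in>I. qc.subspace (V i)) \<and> (\<forall>x. \<exists>!f. decomposition I V x f)"
  unfolding is_direct_sum_def decomposition_def by (simp only: eq_commute [of _ "sum _ _"])

lemma decompositionI:
  assumes "finite S" "\<And>i. i \<in> I \<Longrightarrow> f i \<in> V i" "\<And>i. i \<notin> I \<Longrightarrow> f i = 0"
    "\<And>i. i \<notin> S \<Longrightarrow> f i = 0" "sum f S = x"
  shows "decomposition I V x f"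
proof -
  have sub: "{i. f i \<noteq> 0} \<subseteq> S" using assms(4) by blast
  have "sum f {i. f i \<noteq> 0} = sum f S"
    by (rule sum.mono_neutral_left) (use assms(1) sub in auto)
  then show ?thesis
    using assms finite_subset[OF sub] by (simp add: decomposition_def)
qed

lemma decomposition_add:
  assumes "decomposition I V x f" "decomposition I V y g" "\<And>i. i \<in> I \<Longrightarrow> qc.subspace (V i)"
  shows "decomposition I V (x + y) (\<lambda>i. f i + g i)"
proof (rule decompositionI)
  let ?S = "{i. f i \<noteq> 0} \<union> {i. g i \<noteq> 0}"
  show fin: "finite ?S" using assms by (simp add: decomposition_def)
  have "sum f {i. f i \<noteq> 0} = sum f ?S" "sum g {i. g i \<noteq> 0} = sum g ?S"
    by (rule sum.mono_neutral_left; use fin in auto)+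
  then show "(\<Sum>i\<in>?S. f i + g i) = x + y"
    using assms by (simp add: decomposition_def sum.distrib)
qed (use assms in \<open>auto simp: decomposition_def qc.subspace_add\<close>)

lemma decomposition_scale:
  assumes "decomposition I V x f" "\<And>i. i \<in> I \<Longrightarrow> qc.subspace (V i)"
  shows "decomposition I V (c *q x) (\<lambda>i. c *q f i)"
proof (rule decompositionI)
  show "(\<Sum>i | f i \<noteq> 0. c *q f i) = c *q x"
    using assms by (simp add: decomposition_def flip: qc.scale_sum_right)
qed (use assms in \<open>auto simp: decomposition_def qc.subspace_scale\<close>)

text \<open>
  A family of projections onto the summands yields the decomposition, and applying a projection to
  any other decomposition shows uniqueness.
\<close>

lemma is_direct_sumI:
  assumes sub: "\<And>i. i \<in> I \<Longrightarrow> qc.subspace (V i)"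
    and lin: "\<And>i. i \<in> I \<Longrightarrow> qlinear (P i)"
    and mem: "\<And>i x. i \<in> I \<Longrightarrow> P i x \<in> V i"
    and sum: "\<And>x. \<exists>S \<subseteq> I. finite S \<and> (\<forall>i\<in>I - S. P i x = 0) \<and> (\<Sum>i\<in>S. P i x) = x"
    and proj: "\<And>i j x. i \<in> I \<Longrightarrow> j \<in> I \<Longrightarrow> x \<in> V j \<Longrightarrow> P i x = (if i = j then x else 0)"
  shows "is_direct_sum I V"
  unfolding is_direct_sum_decomposition
proof (intro conjI ballI allI ex1I)
  fix x
  define f where "f i = (if i \<in> I then P i x else 0)" for i
  obtain S where S: "S \<subseteq> I" "finite S" "\<forall>i\<in>I - S. P i x = 0" "(\<Sum>i\<in>S. P i x) = x"
    using sum[of x] by blast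
  show "decomposition I V x f"
  proof (rule decompositionI)
    have "sum f S = (\<Sum>i\<in>S. P i x)"
      using S(1) by (intro sum.cong) (auto simp: f_def)
    then show "sum f S = x" using S(4) by simp
  qed (use S mem in \<open>auto simp: f_def\<close>)
  fix f' assume f': "decomposition I V x f'"
  show "f' = f"
  proof
    fix i
    show "f' i = f i"
    proof (cases "i \<in> I")
      case True
      have "P i x = (\<Sum>j | f' j \<noteq> 0. P i (f' j))"
        using f' qlinear_sum[OF lin[OF True], of f' "{j. f' j \<noteq> 0}"] by (simp add: decomposition_def)
      also have "\<dots> = (\<Sum>j | f' j \<noteq> 0. if i = j then f' j else 0)"
      proof (rule sum.cong)
        fix j assume "j \<in> {j. f' j \<noteq> 0}"
        then have "j \<in> I" "f' j \<in> V j" using f' by (auto simp: decomposition_def)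
        then show "P i (f' j) = (if i = j then f' j else 0)" using proj[OF True] by simp
      qed simp
      also have "\<dots> = f' i"
        using f' by (simp add: decomposition_def sum.delta')
      finally show ?thesis using True by (simp add: f_def)
    next
      case False
      then show ?thesis using f' by (simp add: decomposition_def f_def)
    qed
  qed
qed (use sub in auto)

locale graded_qcayley = comm_group G + char_not_two "TYPE('a)"
  for G :: "('g, 'm) monoid_scheme" (structure)
    and A :: "'g \<Rightarrow> 'a::field qcayley set" +
  assumes grading: "is_grading G A"
begin

definition hom_elt :: "'g \<Rightarrow> 'a qcayley \<Rightarrow> bool" where
  "hom_elt g x \<longleftrightarrow> g \<in> carrier G \<and> x \<in> A g"

definition component :: "'g \<Rightarrow> 'a qcayley \<Rightarrow> 'a qcayley" where
  "component g x = (THE f. decomposition (carrier G) A x f) g"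

lemma subspace_A: "g \<in> carrier G \<Longrightarrow> qc.subspace (A g)"
  and ex1_decomposition: "\<exists>!f. decomposition (carrier G) A x f"
  using grading by (auto simp: is_grading_def is_direct_sum_decomposition)

lemma hom_elt_carrier [simp]: "hom_elt g x \<Longrightarrow> g \<in> carrier G"
  by (simp add: hom_elt_def)

lemma hom_elt_add: "hom_elt g x \<Longrightarrow> hom_elt g y \<Longrightarrow> hom_elt g (x + y)"
  and hom_elt_diff: "hom_elt g x \<Longrightarrow> hom_elt g y \<Longrightarrow> hom_elt g (x - y)"
  and hom_elt_scale: "hom_elt g x \<Longrightarrow> hom_elt g (c *q x)"
  using subspace_A[of g] by (auto simp: hom_elt_def qc.subspace_0 qc.subspace_add qc.subspace_diff qc.subspace_scale)

lemma hom_elt_mult: "hom_elt g x \<Longrightarrow> hom_elt h y \<Longrightarrow> hom_elt (g \<otimes> h) (x \<star> y)"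
  and hom_elt_invol: "hom_elt g x \<Longrightarrow> hom_elt g (qinvol x)"
  using grading unfolding is_grading_def hom_elt_def by (blast intro: m_closed)+

lemma decomposition_component: "decomposition (carrier G) A x (\<lambda>g. component g x)"
  using theI'[OF ex1_decomposition[of x]] by (simp add: component_def)

lemma component_eqI: "decomposition (carrier G) A x f \<Longrightarrow> component g x = f g"
  using ex1_decomposition[of x] decomposition_component[of x] by metis

lemma component_add: "component g (x + y) = component g x + component g y"
  by (rule component_eqI, rule decomposition_add) (auto simp: decomposition_component subspace_A)

lemma component_scale: "component g (c *q x) = c *q component g x"
  by (rule component_eqI, rule decomposition_scale) (auto simp: decomposition_component subspace_A)

lemma qlinear_component: "qlinear (component g)"
  by (simp add: qlinear_iff component_add component_scale)

lemma hom_elt_component: "g \<in> carrier G \<Longrightarrow> hom_elt g (component g x)"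
  using decomposition_component[of x] by (simp add: hom_elt_def decomposition_def)

lemma component_outside: "g \<notin> carrier G \<Longrightarrow> component g x = 0"
  using decomposition_component[of x] by (simp add: decomposition_def)

lemma finite_components: "finite {g. component g x \<noteq> 0}"
  and sum_components: "(\<Sum>g | component g x \<noteq> 0. component g x) = x"
  using decomposition_component[of x] by (simp_all add: decomposition_def)

lemma component_hom_elt: "hom_elt k x \<Longrightarrow> component g x = (if g = k then x else 0)"
proof (rule component_eqI)
  assume "hom_elt k x"
  then show "decomposition (carrier G) A x (\<lambda>g. if g = k then x else 0)"
    by (intro decompositionI[where S = "{k}"]) (auto simp: hom_elt_def qc.subspace_0 subspace_A)
qed

lemma hom_elt_unique: "hom_elt g x \<Longrightarrow> hom_elt k x \<Longrightarrow> x \<noteq> 0 \<Longrightarrow> g = k"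
  by (metis component_hom_elt)

lemma component_nonzero_ex: "x \<noteq> 0 \<Longrightarrow> \<exists>g\<in>carrier G. component g x \<noteq> 0"
proof (rule ccontr)
  assume "x \<noteq> 0" "\<not> (\<exists>g\<in>carrier G. component g x \<noteq> 0)"
  then have "component g x = 0" for g using component_outside by blast
  then show False using sum_components[of x] \<open>x \<noteq> 0\<close> by simp
qed

definition homog_map :: "'g \<Rightarrow> ('a qcayley \<Rightarrow> 'a qcayley) \<Rightarrow> bool" where
  "homog_map f L \<longleftrightarrow> f \<in> carrier G \<and> qlinear L \<and> (\<forall>k x. hom_elt k x \<longrightarrow> hom_elt (f \<otimes> k) (L x))"

lemma homog_map_hom_elt: "homog_map f L \<Longrightarrow> hom_elt k x \<Longrightarrow> hom_elt (f \<otimes> k) (L x)"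
  by (simp add: homog_map_def)

lemma homog_map_one_hom_elt: "homog_map \<one> L \<Longrightarrow> hom_elt k x \<Longrightarrow> hom_elt k (L x)"
  using homog_map_hom_elt[of \<one> L k x] by simp

text \<open>
  Decompose \<open>x\<close>: the only component whose image has degree \<open>f k\<close> is the one of degree \<open>k\<close>.
  By this lemma, everything defined from homogeneous maps is stable under taking components.
\<close>

lemma component_homog_map:
  assumes L: "homog_map f L" and k: "k \<in> carrier G"
  shows "component (f \<otimes> k) (L x) = L (component k x)"
proof -
  let ?S = "{j. component j x \<noteq> 0}"
  have lin: "qlinear L" and f: "f \<in> carrier G" using L by (auto simp: homog_map_def)
  have "L x = (\<Sum>j\<in>?S. L (component j x))"
    using qlinear_sum[OF lin] sum_components[of x] by metis
  then have "component (f \<otimes> k) (L x) = (\<Sum>j\<in>?S. component (f \<otimes> k) (L (component j x)))"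
    by (simp add: qlinear_sum[OF qlinear_component])
  also have "\<dots> = (\<Sum>j\<in>?S. if j = k then L (component j x) else 0)"
  proof (rule sum.cong)
    fix j assume "j \<in> ?S"
    then have j: "j \<in> carrier G" using component_outside by blast
    have "hom_elt (f \<otimes> j) (L (component j x))"
      using L j by (intro homog_map_hom_elt hom_elt_component)
    then show "component (f \<otimes> k) (L (component j x)) = (if j = k then L (component j x) else 0)"
      using f j k by (simp add: component_hom_elt eq_commute)
  qed simp
  also have "\<dots> = L (component k x)"
    using finite_components[of x] qlinear_0[OF lin] by (simp add: sum.delta')
  finally show ?thesis .
qed

lemma component_homog_map_one:
  "homog_map \<one> L \<Longrightarrow> k \<in> carrier G \<Longrightarrow> component k (L x) = L (component k x)"
  using component_homog_map[of \<one> L k x] by simp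

lemma homog_map_compose:
  assumes "homog_map f L" "homog_map f' L'"
  shows "homog_map (f \<otimes> f') (\<lambda>x. L (L' x))"
  using assms by (auto simp: homog_map_def qlinear_compose m_assoc)

lemma homog_map_add:
  assumes "homog_map f L" "homog_map f L'"
  shows "homog_map f (\<lambda>x. L x + L' x)"
  using assms by (auto simp: homog_map_def qlinear_iff hom_elt_add qc.scale_right_distrib)

lemma homog_map_diff:
  assumes "homog_map f L" "homog_map f L'"
  shows "homog_map f (\<lambda>x. L x - L' x)"
  using assms by (auto simp: homog_map_def qlinear_iff hom_elt_diff qc.scale_right_diff_distrib)

lemma homog_map_scale:
  assumes "homog_map f L"
  shows "homog_map f (\<lambda>x. c *q L x)"
  using assms by (auto simp: homog_map_def qlinear_iff hom_elt_scale qc.scale_right_distrib mult.commute)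

lemma homog_map_id: "homog_map \<one> (\<lambda>x. x)"
  by (simp add: homog_map_def qlinear_iff)

lemma homog_map_unique:
  assumes "homog_map f L" "homog_map f' L" "L x \<noteq> 0"
  shows "f = f'"
proof -
  have c: "f \<in> carrier G" "f' \<in> carrier G" and lin: "qlinear L" using assms by (auto simp: homog_map_def)
  obtain k where k: "k \<in> carrier G" "component (f \<otimes> k) (L x) \<noteq> 0"
  proof -
    obtain g where g: "g \<in> carrier G" "component g (L x) \<noteq> 0"
      using component_nonzero_ex[OF assms(3)] by blast
    then have "f \<otimes> (inv f \<otimes> g) = g" using c by (simp add: m_assoc [symmetric])
    then show ?thesis using that[of "inv f \<otimes> g"] g c by simp
  qed
  then have nz: "L (component k x) \<noteq> 0"
    using component_homog_map[OF assms(1)] by simp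
  have "hom_elt (f \<otimes> k) (L (component k x))" "hom_elt (f' \<otimes> k) (L (component k x))"
    using homog_map_hom_elt assms(1,2) hom_elt_component[OF k(1)] by blast+
  then have "f \<otimes> k = f' \<otimes> k" using nz hom_elt_unique by blast
  then show ?thesis using c k by simp
qed

lemma qlinear_mult_left: "qlinear (\<lambda>y. (x :: 'a qcayley) \<star> y)"
  and qlinear_mult_right: "qlinear (\<lambda>y. y \<star> (x :: 'a qcayley))"
proof -
  have "x \<star> (y + z) = x \<star> y + x \<star> z" "(y + z) \<star> x = y \<star> x + z \<star> x"
    "x \<star> (c *q y) = c *q (x \<star> y)" "(c *q y) \<star> x = c *q (y \<star> x)" for y z and c :: 'a
    by (cases x rule: smat_cases; cases y rule: smat_cases; cases z rule: smat_cases;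
        simp add: smat_mult smat_add smat_scale smat_inj tr3_def vec3_eq_iff algebra_simps)+
  then show "qlinear (\<lambda>y. x \<star> y)" "qlinear (\<lambda>y. y \<star> x)"
    by (simp_all add: qlinear_iff)
qed

lemma homog_map_mult_left: "hom_elt f x \<Longrightarrow> homog_map f (\<lambda>y. x \<star> y)"
  by (simp add: homog_map_def qlinear_mult_left hom_elt_mult)

lemma homog_map_mult_right: "hom_elt f x \<Longrightarrow> homog_map f (\<lambda>y. y \<star> x)"
  using hom_elt_mult by (fastforce simp: homog_map_def qlinear_mult_right m_comm)

lemma homog_map_invol: "homog_map \<one> (qinvol :: 'a qcayley \<Rightarrow> 'a qcayley)"
proof -
  have "qinvol (y + z) = qinvol y + qinvol z" "qinvol (c *q y) = c *q qinvol y"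
    for y z :: "'a qcayley" and c :: 'a
    by (cases y rule: smat_cases; cases z rule: smat_cases;
        simp add: smat_invol smat_add smat_scale)+
  then show ?thesis
    by (simp add: homog_map_def qlinear_iff hom_elt_invol)
qed

lemma q1_mult [simp]: "q1 \<star> x = (x :: 'a qcayley)" "x \<star> q1 = (x :: 'a qcayley)"
  by (cases x rule: smat_cases; simp add: q1_smat smat_mult smat_inj tr3_def vec3_eq_iff)+

text \<open>
  The component of \<open>1\<close> in degree \<open>e\<close> acts as a left unit on homogeneous elements, hence on all
  elements, so it is \<open>1\<close>.
\<close>

lemma hom_elt_one: "hom_elt \<one> q1"
proof -
  have "component \<one> q1 \<star> y - y = 0" for y
  proof (rule ccontr)
    have lin: "qlinear (\<lambda>y. component \<one> q1 \<star> y - y)"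
      using qlinear_mult_left[of "component \<one> q1"]
      by (simp add: qlinear_iff qc.scale_right_diff_distrib)
    assume nz: "component \<one> q1 \<star> y - y \<noteq> 0"
    have "component \<one> q1 \<star> component k y = component k y" if "k \<in> carrier G" for k
      using component_homog_map[OF homog_map_mult_right[OF hom_elt_component[OF that]], of \<one> q1 y] that
      by (simp add: component_hom_elt[OF hom_elt_component[OF that]])
    then have "component \<one> q1 \<star> component k y - component k y = 0" for k
      by (cases "k \<in> carrier G") (simp_all add: component_outside qlinear_0[OF qlinear_mult_left])
    then have "(\<Sum>k | component k y \<noteq> 0. component \<one> q1 \<star> component k y - component k y) = 0"
      by simp
    then show False
      using qlinear_sum[OF lin, of "\<lambda>k. component k y" "{k. component k y \<noteq> 0}"] nz
      by (simp only: sum_components)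
  qed
  from this[of q1] have "component \<one> q1 = q1" by simp
  then show ?thesis using hom_elt_component[of \<one> q1] by simp
qed

text \<open>
  The components of \<open>s\<close> are skew like \<open>s\<close>, and the skew elements form the line through \<open>s\<close>.
\<close>

lemma hom_elt_s: obtains h where "hom_elt h qs" "h \<otimes> h = \<one>"
proof -
  have nz: "(qs :: 'a qcayley) \<noteq> 0" by (simp add: qs_smat zero_smat smat_inj)
  obtain h where h: "h \<in> carrier G" "component h qs \<noteq> (0 :: 'a qcayley)"
    using component_nonzero_ex[OF nz] by blast
  have "qinvol (qs :: 'a qcayley) = (- 1) *q qs"
    by (simp add: qs_smat smat_invol smat_scale smat_inj)
  then have inv: "qinvol (component h qs) = (- 1) *q component h (qs :: 'a qcayley)"
    using component_homog_map_one[OF homog_map_invol h(1)] component_scale by metis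
  obtain p q a b where c: "component h qs = smat p q a (b :: 'a ^ 3)" by (rule smat_cases)
  have dbl: "x + x = 0 \<longleftrightarrow> x = 0" for x :: 'a
    by (metis mult_2 mult_eq_0_iff two_nz add_0)
  have "qinvol (component h qs) + component h (qs :: 'a qcayley) = 0"
    unfolding inv using qc.scale_left_distrib[of "- 1" 1 "component h qs"] by simp
  then have "q + p = 0" "a = 0" "b = 0"
    by (simp_all add: c smat_invol smat_add zero_smat smat_inj vec3_eq_iff dbl)
  then have "q = - p" "a = 0" "b = 0"
    by (simp_all add: eq_neg_iff_add_eq_0)
  then have *: "component h qs = p *q qs" unfolding c by (simp add: qs_smat smat_scale smat_inj vec3_eq_iff)
  then have "p \<noteq> 0" using h by auto
  then have "qs = (1 / p) *q component h qs" by (simp add: *)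
  then have hs: "hom_elt h qs"
    using hom_elt_scale[OF hom_elt_component[OF h(1)]] by metis
  have "qs \<star> qs = (q1 :: 'a qcayley)"
    by (simp add: qs_smat q1_smat smat_mult smat_inj tr3_def vec3_eq_iff)
  then have "hom_elt (h \<otimes> h) q1" using hom_elt_mult[OF hs hs] by simp
  moreover have "(q1 :: 'a qcayley) \<noteq> 0" by (simp add: q1_smat zero_smat smat_inj)
  ultimately have "h \<otimes> h = \<one>" using hom_elt_one hom_elt_unique by blast
  with hs show ?thesis by (rule that)
qed

text \<open>
  It suffices to check degrees on a spanning set of the target: by linearity, taking the component
  of degree \<open>g\<close> sends any element into the span of the basis elements of degree \<open>g\<close>.
\<close>

lemma isomorphic_by_basis:
  assumes \<phi>: "is_automorphism \<phi>" and \<psi>: "qlinear \<psi>" "\<And>x. \<phi> (\<psi> x) = x" "\<And>x. \<psi> (\<phi> x) = x"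
    and D: "\<And>x g. (x, g) \<in> D \<Longrightarrow> hom_elt g (\<psi> x)"
    and span: "qc.span (fst ` D) = UNIV"
  shows "isomorphic_gradings G A (graded_by_basis D)"
  unfolding isomorphic_gradings_def
proof (intro exI conjI ballI)
  fix g assume g: "g \<in> carrier G"
  have lin: "qlinear \<phi>" using \<phi> by (simp add: is_automorphism_def)
  show "\<phi> ` A g = graded_by_basis D g"
  proof
    show "\<phi> ` A g \<subseteq> graded_by_basis D g"
    proof
      fix y assume "y \<in> \<phi> ` A g"
      then obtain x where x: "x \<in> A g" "y = \<phi> x" by blast
      have P: "\<phi> (component g (\<psi> z)) \<in> graded_by_basis D g" if "z \<in> qc.span (fst ` D)" for z
        using that
      proof (induction rule: qc.span_induct)
        case base
        show ?case
          unfolding mem_Collect_eq graded_by_basis_def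
          by (simp add: qc.subspace_def qlinear_0[OF lin] qlinear_0[OF \<psi>(1)] qlinear_0[OF qlinear_component]
              qlinear_add[OF lin] qlinear_add[OF \<psi>(1)] component_add qc.span_zero qc.span_add
              qlinear_scale[OF lin] qlinear_scale[OF \<psi>(1)] component_scale qc.span_scale)
      next
        case (step z)
        then obtain k where k: "(z, k) \<in> D" by auto
        show ?case
        proof (cases "g = k")
          case True
          then show ?thesis
            using k D[OF k] \<psi>(2) by (simp add: component_hom_elt graded_by_basis_def qc.span_base)
        next
          case False
          then show ?thesis
            using k D[OF k] by (simp add: component_hom_elt qlinear_0[OF lin] graded_by_basis_def qc.span_zero)
        qed
      qed
      have "component g (\<psi> y) = x"
        using x g component_hom_elt[of g x g] by (simp add: \<psi>(3) hom_elt_def)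
      then show "y \<in> graded_by_basis D g"
        using P[of y] span x by simp
    qed
    show "graded_by_basis D g \<subseteq> \<phi> ` A g"
    proof
      fix y assume "y \<in> graded_by_basis D g"
      then have "y \<in> qc.span {x. (x, g) \<in> D}" by (simp add: graded_by_basis_def)
      then have "\<psi> y \<in> A g"
      proof (induction rule: qc.span_induct)
        case base
        show ?case
          using subspace_A[OF g]
          by (simp add: qc.subspace_def qlinear_0[OF \<psi>(1)] qlinear_add[OF \<psi>(1)] qlinear_scale[OF \<psi>(1)])
      next
        case (step x)
        then show ?case using D by (auto simp: hom_elt_def)
      qed
      then show "y \<in> \<phi> ` A g" using \<psi>(2) by (metis imageI)
    qed
  qed
qed (rule \<phi>)

end

section \<open>Homogeneous diagonal operators\<close>

context char_not_two
begin

lemmas smat_ops = smat_mult smat_add smat_scale smat_diff smat_invol smat_inj vec3_eq_iff tr3_def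

lemma qs_mult_diagonal: "qs \<star> smat (0::'a) 0 a b = smat 0 0 a (- b)"
  by (simp add: qs_smat smat_ops)

text \<open>
  \<open>diag(t\<^sub>1, t\<^sub>2, t\<^sub>3)\<close> on \<open>K x\<^sub>1 + K x\<^sub>2 + K x\<^sub>3\<close>, extended by zero on \<open>K\<close>.
\<close>

definition xdiag :: "'a ^ 3 \<Rightarrow> 'a qcayley \<Rightarrow> 'a qcayley" where
  "xdiag t x = smat 0 0 (t * ma x) (t * mb x)"

lemma xdiag_smat [simp]: "xdiag t (smat p q a b) = smat 0 0 (t * a) (t * b)"
  by (simp add: xdiag_def)

text \<open>
  The idempotent of \<open>F\<^sup>3\<close> whose operator projects onto the component of degree 1 of \<open>\<Gamma>\<^sub>S\<^sup>n\<close>.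
\<close>

definition off_axis :: "nat \<Rightarrow> 'a ^ 3" where
  "off_axis n = vector [if n = 1 then 0 else 1, if n = 2 then 0 else 1, if n = 3 then 0 else 1]"

lemma off_axis_nth [simp]:
  "off_axis n $ 1 = (if n = 1 then 0 else 1)"
  "off_axis n $ 2 = (if n = 2 then 0 else 1)"
  "off_axis n $ 3 = (if n = 3 then 0 else 1)"
  by (simp_all add: off_axis_def)

lemma qK_smat: "(qK :: 'a qcayley set) = {smat p q 0 0 | p q. True}"
proof -
  let ?S = "{smat p q 0 0 | p q. True} :: 'a qcayley set"
  have "qK \<subseteq> ?S"
    unfolding qK_def
  proof (rule qc.span_minimal)
    show "{q1, qs} \<subseteq> ?S"
      using q1_smat qs_smat by blast
    show "qc.subspace ?S"
      unfolding qc.subspace_def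
    proof (intro conjI ballI allI)
      show "0 \<in> ?S" using zero_smat by blast
    next
      fix x y assume "x \<in> ?S" "y \<in> ?S"
      then obtain p q p' q' where "x = smat p q 0 0" "y = smat p' q' 0 0" by blast
      then have "x + y = smat (p + p') (q + q') 0 0" by (simp add: smat_ops)
      then show "x + y \<in> ?S" by blast
    next
      fix c x assume "x \<in> ?S"
      then obtain p q where "x = smat p q 0 0" by blast
      then have "c *q x = smat (c * p) (c * q) 0 0" by (simp add: smat_ops)
      then show "c *q x \<in> ?S" by blast
    qed
  qed
  moreover have "smat p q 0 0 \<in> qK" for p q :: 'a
  proof -
    have "smat p q 0 0 = ((p + q) / 2) *q q1 + ((p - q) / 2) *q qs"
      by (simp add: q1_smat qs_smat smat_ops add_divide_distrib diff_divide_distrib)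
    then show "smat p q 0 0 \<in> qK"
      by (simp add: qK_def qc.span_add qc.span_scale qc.span_base)
  qed
  ultimately show ?thesis by blast
qed

lemma K_mult_diagonal: "smat p q 0 0 \<star> smat (0::'a) 0 v v = smat 0 0 (p *s v) (q *s v)"
  by (simp add: smat_ops)

lemma qx_off_axis: "n \<in> {1, 2, 3} \<Longrightarrow> (qx n :: 'a qcayley) = smat 0 0 (1 - off_axis n) (1 - off_axis n)"
  by (elim insertE emptyE) (simp_all add: qx_smat Let_def smat_inj vec3_eq_iff)

lemma off_axis_kernel: "n \<in> {1, 2, 3} \<Longrightarrow> off_axis n * a = 0 \<longleftrightarrow> (\<exists>c. a = c *s (1 - off_axis n))"
proof
  assume n: "n \<in> {1, 2, 3}" and *: "off_axis n * a = 0"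
  have "a = (a $ 1 + a $ 2 + a $ 3) *s (1 - off_axis n)"
    using n * by (elim insertE emptyE) (simp_all add: vec3_eq_iff)
  then show "\<exists>c. a = c *s (1 - off_axis n)" by blast
next
  assume "\<exists>c. a = c *s (1 - off_axis n)"
  then show "off_axis n * a = 0" by (auto simp: vec3_eq_iff)
qed

lemma GammaS_zero:
  assumes n: "n \<in> {1, 2, 3}"
  shows "GammaS n 0 = {x :: 'a qcayley. xdiag (off_axis n) x = 0}"
proof -
  have "x \<in> GammaS n 0 \<longleftrightarrow> xdiag (off_axis n) x = 0" for x :: "'a qcayley"
  proof -
    obtain p q a b where x: "x = smat p q a b" by (rule smat_cases)
    have "x \<in> GammaS n 0 \<longleftrightarrow> (\<exists>r\<in>qK. \<exists>r'\<in>qK. x = r + r' \<star> qx n)"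
      unfolding GammaS_def by auto
    also have "\<dots> \<longleftrightarrow> (\<exists>p q p' q'. x = smat p q 0 0 + smat p' q' 0 0 \<star> qx n)"
      unfolding qK_smat by blast
    also have "\<dots> \<longleftrightarrow> (\<exists>p' q'. a = p' *s (1 - off_axis n) \<and> b = q' *s (1 - off_axis n))"
      by (simp add: x qx_off_axis[OF n] K_mult_diagonal smat_add smat_inj)
    also have "\<dots> \<longleftrightarrow> off_axis n * a = 0 \<and> off_axis n * b = 0"
      unfolding off_axis_kernel[OF n] by blast
    also have "\<dots> \<longleftrightarrow> xdiag (off_axis n) x = 0"
      unfolding x zero_smat xdiag_smat smat_inj by simp
    finally show ?thesis .
  qed
  then show ?thesis by blast
qed

lemma sum_two_axes:
  assumes n: "n \<in> {1, 2, 3}"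
  shows "(\<Sum>j\<in>{1, 2, 3} - {n}. smat (p j) (q j) 0 0 \<star> qx j) =
    smat (0::'a) 0 (off_axis n * vector [p 1, p 2, p 3]) (off_axis n * vector [q 1, q 2, q 3])"
proof -
  have S: "{1, 2, 3} - {1} = {2, 3 :: nat}" "{1, 2, 3} - {2} = {1, 3 :: nat}" "{1, 2, 3} - {3} = {1, 2 :: nat}"
    by auto
  have x: "smat (p j) (q j) 0 0 \<star> qx j = smat 0 0 (p j *s (1 - off_axis j)) (q j *s (1 - off_axis j))"
    if "j \<in> {1, 2, 3}" for j
    using that by (simp only: qx_off_axis K_mult_diagonal)
  consider "n = 1" | "n = 2" | "n = 3" using n by blast
  then show ?thesis
  proof cases
    case 1
    show ?thesis unfolding 1 S using x[of 2] x[of 3] by (simp add: smat_add smat_inj vec3_eq_iff)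
  next
    case 2
    show ?thesis unfolding 2 S using x[of 1] x[of 3] by (simp add: smat_add smat_inj vec3_eq_iff)
  next
    case 3
    show ?thesis unfolding 3 S using x[of 1] x[of 2] by (simp add: smat_add smat_inj vec3_eq_iff)
  qed
qed

lemma GammaS_one:
  assumes n: "n \<in> {1, 2, 3}"
  shows "GammaS n 1 = {x :: 'a qcayley. xdiag (off_axis n) x = x}"
proof -
  have "x \<in> GammaS n 1 \<longleftrightarrow> xdiag (off_axis n) x = x" for x :: "'a qcayley"
  proof -
    have "x \<in> GammaS n 1 \<longleftrightarrow> (\<exists>r. (\<forall>j. r j \<in> qK) \<and> x = (\<Sum>j\<in>{1, 2, 3} - {n}. r j \<star> qx j))"
      unfolding GammaS_def by auto
    also have "\<dots> \<longleftrightarrow> (\<exists>p q. x = (\<Sum>j\<in>{1, 2, 3} - {n}. smat (p j) (q j) 0 0 \<star> qx j))"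
    proof
      assume "\<exists>r. (\<forall>j. r j \<in> qK) \<and> x = (\<Sum>j\<in>{1, 2, 3} - {n}. r j \<star> qx j)"
      then obtain r where r: "\<forall>j. r j \<in> qK" and x: "x = (\<Sum>j\<in>{1, 2, 3} - {n}. r j \<star> qx j)"
        by blast
      from r have "\<forall>j. \<exists>p q. r j = smat p q 0 0" unfolding qK_smat by blast
      then obtain p q where "\<And>j. r j = smat (p j) (q j) 0 0" by metis
      then show "\<exists>p q. x = (\<Sum>j\<in>{1, 2, 3} - {n}. smat (p j) (q j) 0 0 \<star> qx j)" using x by auto
    next
      assume "\<exists>p q. x = (\<Sum>j\<in>{1, 2, 3} - {n}. smat (p j) (q j) 0 0 \<star> qx j)"
      then obtain p q where x: "x = (\<Sum>j\<in>{1, 2, 3} - {n}. smat (p j) (q j) 0 0 \<star> qx j)" by blast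
      have "\<forall>j. smat (p j) (q j) 0 0 \<in> qK" unfolding qK_smat by blast
      with x show "\<exists>r. (\<forall>j. r j \<in> qK) \<and> x = (\<Sum>j\<in>{1, 2, 3} - {n}. r j \<star> qx j)"
        by (intro exI[of _ "\<lambda>j. smat (p j) (q j) 0 0"] conjI)
    qed
    also have "\<dots> \<longleftrightarrow> (\<exists>p q. x = smat 0 0 (off_axis n * vector [p (1::nat), p 2, p 3])
        (off_axis n * vector [q (1::nat), q 2, q 3]))"
      unfolding sum_two_axes[OF n] ..
    also have "\<dots> \<longleftrightarrow> xdiag (off_axis n) x = x"
    proof
      assume "\<exists>p q. x = smat 0 0 (off_axis n * vector [p (1::nat), p 2, p 3])
        (off_axis n * vector [q (1::nat), q 2, q 3])"
      then obtain c d where "x = smat 0 0 (off_axis n * c) (off_axis n * d)" by blast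
      then show "xdiag (off_axis n) x = x" by (simp add: smat_inj vec3_eq_iff)
    next
      assume *: "xdiag (off_axis n) x = x"
      obtain p q a b where x: "x = smat p q a b" by (rule smat_cases)
      have "vector [a $ of_nat 1, a $ of_nat 2, a $ 3] = a" "vector [b $ of_nat 1, b $ of_nat 2, b $ 3] = b"
        by (simp_all add: vec3_eq_iff)
      then have "x = smat 0 0 (off_axis n * vector [a $ of_nat 1, a $ of_nat 2, a $ of_nat 3])
          (off_axis n * vector [b $ of_nat (1::nat), b $ of_nat 2, b $ of_nat 3])"
        using * unfolding x by (simp add: smat_inj)
      then show "\<exists>p q. x = smat 0 0 (off_axis n * vector [p (1::nat), p 2, p 3])
        (off_axis n * vector [q (1::nat), q 2, q 3])"
        by (intro exI[of _ "\<lambda>j. a $ of_nat j"] exI[of _ "\<lambda>j. b $ of_nat j"])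
    qed
    finally show ?thesis .
  qed
  then show ?thesis by blast
qed

end

context graded_qcayley
begin

definition hdiag :: "'g \<Rightarrow> 'a ^ 3 \<Rightarrow> bool" where
  "hdiag f t \<longleftrightarrow> homog_map f (xdiag t)"

lemma hdiag_carrier: "hdiag f t \<Longrightarrow> f \<in> carrier G"
  by (simp add: hdiag_def homog_map_def)

lemma hdiag_hom_elt:
  "hdiag f t \<Longrightarrow> hom_elt k (smat p q a b) \<Longrightarrow> hom_elt (f \<otimes> k) (smat 0 0 (t * a) (t * b))"
  using homog_map_hom_elt[of f "xdiag t" k "smat p q a b"] by (simp add: hdiag_def)

lemma hdiag_add: "hdiag f t \<Longrightarrow> hdiag f t' \<Longrightarrow> hdiag f (t + t')"
proof -
  assume a: "hdiag f t" "hdiag f t'"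
  have "(\<lambda>x. xdiag t x + xdiag t' x) = xdiag (t + t')"
    by (rule ext, case_tac x rule: smat_cases) (simp add: smat_ops algebra_simps)
  then show ?thesis using homog_map_add[of f "xdiag t" "xdiag t'"] a by (simp add: hdiag_def)
qed

lemma hdiag_scale: "hdiag f t \<Longrightarrow> hdiag f (c *s t)"
proof -
  assume a: "hdiag f t"
  have "(\<lambda>x. c *q xdiag t x) = xdiag (c *s t)"
    by (rule ext, case_tac x rule: smat_cases) (simp add: smat_ops algebra_simps)
  then show ?thesis using homog_map_scale[of f "xdiag t" c] a by (simp add: hdiag_def)
qed

lemma hdiag_mult: "hdiag f t \<Longrightarrow> hdiag f' t' \<Longrightarrow> hdiag (f \<otimes> f') (t * t')"
proof -
  assume a: "hdiag f t" "hdiag f' t'"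
  have "(\<lambda>x. xdiag t (xdiag t' x)) = xdiag (t * t')"
    by (rule ext, case_tac x rule: smat_cases) (simp add: smat_ops algebra_simps)
  then show ?thesis using homog_map_compose[of f "xdiag t" f' "xdiag t'"] a by (simp add: hdiag_def)
qed

text \<open>
  \<open>x \<mapsto> (s x) s\<close> is the identity on \<open>K\<close> and \<open>-1\<close> on the \<open>K x\<^sub>i\<close>, and has degree \<open>h\<^sup>2 = e\<close>.
\<close>

lemma hdiag_one: "hdiag \<one> 1"
proof -
  obtain h where h: "hom_elt h qs" "h \<otimes> h = \<one>" by (rule hom_elt_s)
  have "homog_map (h \<otimes> h) (\<lambda>x. (qs \<star> x) \<star> qs)"
    by (rule homog_map_compose[OF homog_map_mult_right homog_map_mult_left]) (rule h)+
  then have "homog_map \<one> (\<lambda>x. (1 / 2) *q (x - (qs \<star> x) \<star> qs))"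
    using h by (intro homog_map_scale homog_map_diff homog_map_id) simp
  moreover have "(\<lambda>x. (1 / 2) *q (x - (qs \<star> x) \<star> qs)) = xdiag 1"
    by (rule ext, case_tac x rule: smat_cases) (simp add: qs_smat smat_ops)
  ultimately show ?thesis by (simp add: hdiag_def)
qed

lemma hdiag_unique: "hdiag f t \<Longrightarrow> hdiag f' t \<Longrightarrow> t \<noteq> 0 \<Longrightarrow> f = f'"
  using homog_map_unique[of f "xdiag t" f' "smat 0 0 1 1"] by (simp add: hdiag_def zero_smat smat_inj)

definition K_part :: "'a qcayley \<Rightarrow> 'a qcayley" where
  "K_part x = x - xdiag 1 x"

lemma K_part_smat [simp]: "K_part (smat p q a b) = smat p q 0 0"
  by (simp add: K_part_def smat_ops)

lemma homog_map_K_part: "homog_map \<one> K_part"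
  unfolding K_part_def using hdiag_one by (intro homog_map_diff homog_map_id) (simp add: hdiag_def)

lemma hom_elt_K_part: "hom_elt k x \<Longrightarrow> hom_elt k (K_part x)"
  by (rule homog_map_one_hom_elt[OF homog_map_K_part])

text \<open>
  Write \<open>w v = \<langle>w, v\<rangle> + w * v\<close> with the first summand in \<open>K\<close> and the second in the sum \<open>W\<close> of the
  \<open>K x\<^sub>i\<close>. For \<open>x \<in> W\<close>, expanding \<open>w * (v * x)\<close> in the coordinates of \<open>w = \<Sum> r\<^sub>i x\<^sub>i\<close> and
  \<open>v = \<Sum> r'\<^sub>i x\<^sub>i\<close> gives
  \<open>\<langle>v, w\<rangle> x + \<langle>x, w\<rangle> v - w * (v * x) = 2 diag(r\<^sub>i\<^sup>* r'\<^sub>i) x\<close>. The entries on the right lie in \<open>K\<close>; adding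
  the same equation with \<open>w\<close> and \<open>v\<close> exchanged makes them scalars.
\<close>

lemma hdiag_polar:
  assumes "hom_elt k (smat 0 0 a b)" "hom_elt l (smat 0 0 c d)"
  shows "hdiag (k \<otimes> l) (a * d + b * c)"
proof -
  define Q where "Q w v x = K_part (v \<star> w) \<star> xdiag 1 x + K_part (xdiag 1 x \<star> w) \<star> v
    - xdiag 1 (w \<star> xdiag 1 (v \<star> xdiag 1 x))" for w v x :: "'a qcayley"
  have W: "homog_map \<one> (xdiag 1)" using hdiag_one by (simp add: hdiag_def)
  have Q: "homog_map (k \<otimes> l) (Q w v)" if w: "hom_elt k w" and v: "hom_elt l v" for k l w v
  proof -
    have kl: "k \<in> carrier G" "l \<in> carrier G" using that by auto
    have "homog_map (l \<otimes> k \<otimes> \<one>) (\<lambda>x. K_part (v \<star> w) \<star> xdiag 1 x)"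
      by (rule homog_map_compose[OF homog_map_mult_left W]) (intro hom_elt_K_part hom_elt_mult that)
    moreover have "homog_map (l \<otimes> (\<one> \<otimes> (k \<otimes> \<one>))) (\<lambda>x. K_part (xdiag 1 x \<star> w) \<star> v)"
      by (rule homog_map_compose[OF homog_map_mult_right[OF v]
            homog_map_compose[OF homog_map_K_part homog_map_compose[OF homog_map_mult_right[OF w] W]]])
    moreover have "homog_map (\<one> \<otimes> (k \<otimes> (\<one> \<otimes> (l \<otimes> \<one>)))) (\<lambda>x. xdiag 1 (w \<star> xdiag 1 (v \<star> xdiag 1 x)))"
      by (rule homog_map_compose[OF W homog_map_compose[OF homog_map_mult_left[OF w]
            homog_map_compose[OF W homog_map_compose[OF homog_map_mult_left[OF v] W]]]])
    moreover have "l \<otimes> k = k \<otimes> l" using kl by (simp add: m_comm)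
    ultimately show ?thesis unfolding Q_def using kl
      by (intro homog_map_diff homog_map_add) simp_all
  qed
  define w v where "w = smat 0 0 a b" and "v = smat 0 0 c d"
  have kl: "k \<in> carrier G" "l \<in> carrier G" using assms by auto
  have "homog_map (k \<otimes> l) (\<lambda>x. (1 / 2) *q (Q w v x + Q v w x))"
    using Q[of k w l v] Q[of l v k w] assms kl
    by (intro homog_map_scale homog_map_add) (simp_all add: w_def v_def m_comm)
  moreover have "(\<lambda>x. (1 / 2) *q (Q w v x + Q v w x)) = xdiag (a * d + b * c)"
  proof (rule ext)
    fix x :: "'a qcayley"
    obtain p q e f where x: "x = smat p q e f" by (rule smat_cases)
    have "Q w v x + Q v w x = 2 *q xdiag (a * d + b * c) x"
      unfolding Q_def x w_def v_def by (simp add: smat_ops) (simp add: algebra_simps)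
    then show "(1 / 2) *q (Q w v x + Q v w x) = xdiag (a * d + b * c) x" by simp
  qed
  ultimately show ?thesis by (simp add: hdiag_def)
qed

text \<open>
  The symmetrized \<open>K\<close>-part of the product is the trace times \<open>1\<close>, and \<open>1\<close> has degree \<open>e\<close>.
\<close>

lemma degree_of_trace:
  assumes "hom_elt k (smat 0 0 a b)" "hom_elt l (smat 0 0 c d)" "tr3 (a * d + b * c) \<noteq> 0"
  shows "k \<otimes> l = \<one>"
proof -
  have kl: "k \<in> carrier G" "l \<in> carrier G" using assms by auto
  let ?w = "smat 0 0 a b" and ?v = "smat 0 0 c d"
  have "hom_elt (k \<otimes> l) (K_part (?w \<star> ?v + ?v \<star> ?w))"
    using hom_elt_mult[OF assms(1,2)] hom_elt_mult[OF assms(2,1)] kl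
    by (intro hom_elt_K_part hom_elt_add) (simp_all add: m_comm)
  moreover have "K_part (?w \<star> ?v + ?v \<star> ?w) = tr3 (a * d + b * c) *q q1"
    by (simp add: q1_smat smat_ops algebra_simps)
  moreover have "hom_elt \<one> (tr3 (a * d + b * c) *q q1)"
    by (intro hom_elt_scale hom_elt_one)
  moreover have "tr3 (a * d + b * c) *q q1 \<noteq> 0"
    using assms(3) by (simp add: q1_smat smat_scale zero_smat smat_inj)
  ultimately show ?thesis by (metis hom_elt_unique)
qed

text \<open>
  The operator of \<open>off_axis n\<close> and its complement are the two projections of \<open>\<Gamma>\<^sub>S\<^sup>n\<close>; being homogeneous
  of degree \<open>e\<close>, they commute with taking components.
\<close>

lemma compatible_GammaS:
  assumes n: "n \<in> {1, 2, 3}" and hd: "hdiag \<one> (off_axis n)"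
  shows "compatible_gradings G (integer_mod_group 2) A (GammaS n)"
proof -
  define E where "E = xdiag (off_axis n)"
  have E: "homog_map \<one> E" using hd by (simp add: E_def hdiag_def)
  then have linE: "qlinear E" by (simp add: homog_map_def)
  have EE: "E (E x) = E x" for x
    by (cases x rule: smat_cases) (simp add: E_def smat_ops)
  define L where "L d x = (if d = 0 then x - E x else E x)" for d :: int and x
  have L: "homog_map \<one> (L d)" for d
    using homog_map_diff[OF homog_map_id E] E by (cases "d = 0") (simp_all add: L_def [abs_def])
  have linL: "qlinear (L d)" for d using L[of d] by (simp add: homog_map_def)
  have carrier: "carrier (integer_mod_group 2) = {0, 1}"
    by (auto simp: carrier_integer_mod_group)
  have GS: "GammaS n d = {x. L d x = x}" if "d \<in> {0, 1}" for d
    using that GammaS_zero[OF n] GammaS_one[OF n] by (auto simp: L_def E_def)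
  have LL: "L d (L d' x) = (if d = d' then L d x else 0)" if "d \<in> {0, 1}" "d' \<in> {0, 1}" for d d' x
    using that by (auto simp: L_def EE qlinear_diff[OF linE])
  have "is_direct_sum (carrier G \<times> {0, 1}) (\<lambda>(g, d). A g \<inter> GammaS n d)"
  proof (rule is_direct_sumI[where P = "\<lambda>(g, d) x. L d (component g x)"], goal_cases)
    case (1 i)
    moreover have "qc.subspace {x. L d x = x}" for d
      using linL[of d] by (simp add: qc.subspace_def qlinear_iff qlinear_0[OF linL])
    ultimately show ?case
      using GS by (auto simp: subspace_A intro!: qc.subspace_inter)
  next
    case (2 i)
    then show ?case
      using qlinear_compose[OF linL qlinear_component] by auto
  next
    case (3 i x)
    obtain g d where i: "i = (g, d)" by (cases i)
    then have gd: "g \<in> carrier G" "d \<in> {0, 1}" using 3 by auto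
    have "hom_elt g (L d (component g x))"
      using homog_map_one_hom_elt[OF L hom_elt_component[OF gd(1)]] .
    moreover have "L d (component g x) \<in> GammaS n d"
      using gd by (simp add: GS LL)
    ultimately show ?case by (simp add: i hom_elt_def)
  next
    case (4 x)
    let ?T = "{g. component g x \<noteq> 0}"
    have T: "?T \<subseteq> carrier G" using component_outside by blast
    have "(\<Sum>(g, d)\<in>?T \<times> {0, 1 :: int}. L d (component g x)) = (\<Sum>g\<in>?T. \<Sum>d\<in>{0, 1}. L d (component g x))"
      by (rule sum.cartesian_product [symmetric])
    also have "\<dots> = (\<Sum>g\<in>?T. component g x)"
      by (rule sum.cong) (simp_all add: L_def)
    finally have "(\<Sum>(g, d)\<in>?T \<times> {0, 1 :: int}. L d (component g x)) = x"
      by (simp add: sum_components)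
    then show ?case
      using T finite_components[of x] qlinear_0[OF linL]
      by (intro exI[of _ "?T \<times> {0, 1}"]) (auto simp: case_prod_unfold)
  next
    case (5 i j x)
    obtain g d where i: "i = (g, d)" by (cases i)
    obtain g' d' where j: "j = (g', d')" by (cases j)
    have d: "g \<in> carrier G" "g' \<in> carrier G" "d \<in> {0, 1}" "d' \<in> {0, 1}" using 5 i j by auto
    have x: "hom_elt g' x" "L d' x = x" using 5(3) d GS by (auto simp: j hom_elt_def)
    have "L d x = (if d = d' then x else 0)" using LL[OF d(3,4), of x] x(2) by auto
    then show ?case
      using x by (auto simp: i j component_hom_elt qlinear_0[OF linL])
  qed
  then show ?thesis by (simp add: compatible_gradings_def carrier)
qed

section \<open>The diagonal grading has a cubic generator\<close>

lemma hdiag_diff: "hdiag f t \<Longrightarrow> hdiag f t' \<Longrightarrow> hdiag f (t - t')"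
  using hdiag_add[of f t "(- 1) *s t'"] hdiag_scale[of f t' "- 1"] by (simp add: vec3_eq_iff)

lemma component_diagonal:
  obtains c d where "component k (smat 0 0 a b) = smat 0 0 c d"
proof (cases "k \<in> carrier G")
  case True
  have "component k (smat 0 0 a b) = xdiag 1 (component k (smat 0 0 a b))"
    using component_homog_map_one[OF _ True, of "xdiag 1" "smat 0 0 a b"] hdiag_one by (simp add: hdiag_def)
  then show ?thesis using that by (simp add: xdiag_def)
next
  case False
  then show ?thesis using that[of 0 0] by (simp add: component_outside zero_smat)
qed

text \<open>
  A bilinear expression that lies in an additive submonoid for homogeneous arguments lies in it
  for all arguments.
\<close>

lemma polar_induct:
  assumes zero: "P 0" and add: "\<And>u v. P u \<Longrightarrow> P v \<Longrightarrow> P (u + v)"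
    and hom: "\<And>k l a b c d. hom_elt k (smat 0 0 a b) \<Longrightarrow> hom_elt l (smat 0 0 c d) \<Longrightarrow> P (a * d + b * c)"
  shows "P (a * d + b * c :: 'a ^ 3)"
proof -
  define B where "B x y = ma x * mb y + mb x * ma y" for x y
  have Badd: "B (x + x') y = B x y + B x' y" and Bsym: "B x y = B y x" for x x' y
    by (cases x rule: smat_cases, cases x' rule: smat_cases,
        cases y rule: smat_cases, simp add: B_def smat_add algebra_simps)+
  have B0: "B 0 y = 0" for y by (simp add: B_def zero_smat)
  have Bsum: "P (B (sum f S) y)" if "\<And>i. i \<in> S \<Longrightarrow> P (B (f i) y)" for f y and S :: "'g set"
    using that by (induction S rule: infinite_finite_induct) (auto simp: B0 Badd zero add)
  have step: "P (B (smat 0 0 a b) y)"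
    if y: "\<And>k c d. hom_elt k (smat 0 0 c d) \<Longrightarrow> P (B (smat 0 0 c d) y)" for a b y
  proof -
    let ?x = "smat 0 0 a b"
    have "P (B (component k ?x) y)" if "k \<in> carrier G" for k
      using hom_elt_component[OF that, of ?x] component_diagonal[of k a b] y by metis
    then have "P (B (\<Sum>k | component k ?x \<noteq> 0. component k ?x) y)"
      using component_outside by (intro Bsum) blast
    then show ?thesis by (simp only: sum_components)
  qed
  have "P (B (smat 0 0 c' d') (smat 0 0 a b))" if "hom_elt l (smat 0 0 c' d')" for l c' d'
  proof -
    have "P (B (smat 0 0 a b) (smat 0 0 c' d'))"
      by (rule step) (use hom[OF _ that] in \<open>simp add: B_def\<close>)
    then show ?thesis by (simp only: Bsym)
  qed
  then have "P (B (smat 0 0 c d) (smat 0 0 a b))" by (rule step)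
  then show ?thesis by (simp add: B_def add.commute mult.commute)
qed

end

text \<open>
  The equation \<open>1 + \<zeta> + \<zeta>\<^sup>2 = 0\<close> says that \<open>\<zeta>\<close> is a primitive cubic root of unity.
\<close>

locale incompatible_qcayley = graded_qcayley G A
  for G :: "('g, 'm) monoid_scheme" (structure)
    and A :: "'g \<Rightarrow> 'a::alg_closed_field qcayley set" +
  fixes \<zeta> :: 'a
  assumes three_nz [simp]: "(3::'a) \<noteq> 0"
    and zeta_sum: "1 + \<zeta> + \<zeta> ^ 2 = 0"
    and incompatible: "\<And>n. n \<in> {1, 2, 3} \<Longrightarrow> \<not> compatible_gradings G (integer_mod_group 2) A (GammaS n)"
begin

lemma not_hdiag_off_axis: "n \<in> {1, 2, 3} \<Longrightarrow> \<not> hdiag \<one> (off_axis n)"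
  using compatible_GammaS incompatible by blast

text \<open>
  If the coordinates of \<open>t\<close> are not all equal, then one of them, say \<open>t\<^sub>i\<close>, differs from both others
  \<open>t\<^sub>j\<close> and \<open>t\<^sub>k\<close>, and \<open>(t - t\<^sub>j) (t - t\<^sub>k)\<close> is a nonzero multiple of the idempotent of coordinate \<open>i\<close>.
  That idempotent would have degree \<open>e\<close>, and the grading would be compatible with \<open>\<Gamma>\<^sub>S\<^sup>i\<close>.
\<close>

lemma hdiag_one_scalar:
  assumes t: "hdiag \<one> t"
  shows "t = (t $ 1) *s 1"
proof (rule ccontr)
  assume ns: "t \<noteq> (t $ 1) *s 1"
  have hd: "hdiag \<one> (1 - c *s ((t - x *s 1) * (t - y *s 1)))" for c x y
    using hdiag_mult[of \<one> "t - x *s 1" \<one> "t - y *s 1"] t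
    by (intro hdiag_diff hdiag_scale) (auto intro!: hdiag_diff hdiag_scale hdiag_one)
  consider "t $ 1 \<noteq> t $ 2" "t $ 1 \<noteq> t $ 3" | "t $ 2 \<noteq> t $ 1" "t $ 2 \<noteq> t $ 3" | "t $ 3 \<noteq> t $ 1" "t $ 3 \<noteq> t $ 2"
  proof -
    have "t $ 2 \<noteq> t $ 1 \<or> t $ 3 \<noteq> t $ 1" using ns by (auto simp: vec3_eq_iff)
    then show ?thesis using that by metis
  qed
  then show False
  proof cases
    case 1
    then have "off_axis 1 = 1 - (1 / ((t $ 1 - t $ 2) * (t $ 1 - t $ 3))) *s ((t - (t $ 2) *s 1) * (t - (t $ 3) *s 1))"
      by (simp add: vec3_eq_iff)
    then show False using hd not_hdiag_off_axis[of 1] by simp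
  next
    case 2
    then have "off_axis 2 = 1 - (1 / ((t $ 2 - t $ 1) * (t $ 2 - t $ 3))) *s ((t - (t $ 1) *s 1) * (t - (t $ 3) *s 1))"
      by (simp add: vec3_eq_iff)
    then show False using hd not_hdiag_off_axis[of 2] by simp
  next
    case 3
    then have "off_axis 3 = 1 - (1 / ((t $ 3 - t $ 1) * (t $ 3 - t $ 2))) *s ((t - (t $ 1) *s 1) * (t - (t $ 2) *s 1))"
      by (simp add: vec3_eq_iff)
    then show False using hd not_hdiag_off_axis[of 3] by simp
  qed
qed

lemma tr3_add: "tr3 (u + v) = tr3 u + tr3 (v :: 'a ^ 3)"
  by (simp add: tr3_def)

text \<open>
  Choose homogeneous \<open>w\<close> and \<open>w'\<close> whose diagonal operator has nonzero trace. It has degree \<open>e\<close>, so it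
  is a nonzero scalar. Replacing \<open>w\<close> by \<open>t w\<close> multiplies it by \<open>t\<close> and shifts the degree to \<open>g \<noteq> e\<close>, where the
  trace must vanish.
\<close>

lemma hdiag_trace:
  assumes t: "hdiag g t" and g: "g \<noteq> \<one>"
  shows "tr3 t = 0"
proof -
  obtain k l a b c d where w: "hom_elt k (smat 0 0 a b)" "hom_elt l (smat 0 0 c d)"
    and tr: "tr3 (a * d + b * c) \<noteq> 0"
  proof (rule ccontr)
    assume "\<not> thesis"
    then have "\<And>k l a b c d. hom_elt k (smat 0 0 a b) \<Longrightarrow> hom_elt l (smat 0 0 c d) \<Longrightarrow> tr3 (a * d + b * c) = 0"
      using that by blast
    then have "tr3 (a * d + b * c) = 0" for a b c d :: "'a ^ 3"
      by (rule polar_induct[where P = "\<lambda>v. tr3 v = 0", rotated 2]) (simp_all add: tr3_add, simp add: tr3_def)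
    from this[of "vector [1, 0, 0]" 1 0 0] show False by (simp add: tr3_def)
  qed
  have kl: "k \<in> carrier G" "l \<in> carrier G" and gc: "g \<in> carrier G" using w t hdiag_carrier by auto
  have e: "k \<otimes> l = \<one>" using degree_of_trace[OF w tr] .
  obtain s where s: "a * d + b * c = s *s 1"
    using hdiag_one_scalar hdiag_polar[OF w] unfolding e by blast
  have "s \<noteq> 0" using tr unfolding s by (auto simp: tr3_def)
  have "g \<otimes> k \<otimes> l \<noteq> \<one>" using e g gc kl by (simp add: m_assoc)
  then have "tr3 (t * a * d + t * b * c) = 0"
    using degree_of_trace[OF hdiag_hom_elt[OF t w(1)] w(2)] by blast
  also have "t * a * d + t * b * c = t * (s *s 1)" unfolding s [symmetric] by (simp add: algebra_simps)
  finally have "s * tr3 t = 0" by (simp add: tr3_def algebra_simps)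
  then show ?thesis using \<open>s \<noteq> 0\<close> by simp
qed

text \<open>
  The diagonal operators obtained from all pairs of elements of \<open>W\<close> include nonscalar ones.
\<close>

lemma hdiag_nontrivial:
  obtains f t where "hdiag f t" "f \<noteq> \<one>" "t \<noteq> 0"
proof (rule ccontr)
  assume "\<not> thesis"
  then have tr: "hdiag f t \<Longrightarrow> t = (t $ 1) *s 1" for f t
    using that hdiag_one_scalar by (cases "t = 0") auto
  have "v = (v $ 1) *s 1" if "v = a * d + b * c" for v a b c d :: "'a ^ 3"
    unfolding that
  proof (rule polar_induct[where P = "\<lambda>v. v = (v $ 1) *s 1"])
    fix k l a b c d assume "hom_elt k (smat 0 0 a b)" "hom_elt l (smat 0 0 c d)"
    then show "a * d + b * c = ((a * d + b * c) $ 1) *s 1" by (rule tr[OF hdiag_polar])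
  qed (auto simp: vec3_eq_iff)
  from this[of "vector [1, 0, 0]" "vector [1, 0, 0]" 1 0 0] show False by (simp add: vec3_eq_iff)
qed

lemma zeta_cube: "\<zeta> ^ 3 = 1"
proof -
  have "\<zeta> ^ 3 - 1 = (\<zeta> - 1) * (1 + \<zeta> + \<zeta> ^ 2)"
    by (simp add: algebra_simps power2_eq_square power3_eq_cube)
  then show ?thesis by (simp add: zeta_sum)
qed

lemma zeta_square: "\<zeta> ^ 2 = - 1 - \<zeta>"
  using zeta_sum by (simp add: eq_diff_eq eq_neg_iff_add_eq_0 add_ac)

lemma cube_root_pair:
  assumes "x ^ 2 + x * y + y ^ 2 = 0"
  shows "y = \<zeta> * x \<or> y = \<zeta> ^ 2 * (x::'a)"
proof -
  have "(y - \<zeta> * x) * (y - \<zeta> ^ 2 * x) = \<zeta> ^ 3 * x ^ 2 - (\<zeta> + \<zeta> ^ 2) * (x * y) + y ^ 2"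
    by (simp add: algebra_simps power2_eq_square power3_eq_cube)
  also have "\<zeta> + \<zeta> ^ 2 = - 1" using zeta_square by simp
  finally have "(y - \<zeta> * x) * (y - \<zeta> ^ 2 * x) = x ^ 2 + x * y + y ^ 2" by (simp add: zeta_cube)
  then show ?thesis using assms by simp
qed

definition omega :: "'a ^ 3" where
  "omega = vector [1, \<zeta>, \<zeta> ^ 2]"

lemma omega_nth [simp]: "omega $ 1 = 1" "omega $ 2 = \<zeta>" "omega $ 3 = \<zeta> ^ 2"
  by (simp_all add: omega_def)

text \<open>
  If \<open>t\<close> and \<open>t\<^sup>3\<close> have trace zero, so does \<open>3 t\<^sub>1 t\<^sub>2 t\<^sub>3\<close> (the trace of \<open>t\<^sup>3\<close>), and \<open>t\<close> has the form
  \<open>c (0, 1, -1)\<close> up to order. Then \<open>t\<^sup>2\<close> is a multiple of an idempotent, which forces \<open>f\<^sup>2 = e\<close> and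
  makes the grading compatible with some \<open>\<Gamma>\<^sub>S\<^sup>i\<close>.
\<close>

lemma hdiag_cube:
  assumes t: "hdiag f t" and f: "f \<noteq> \<one>" and nz: "t \<noteq> 0"
  shows "f \<otimes> f \<otimes> f = \<one>"
proof (rule ccontr)
  have fc: "f \<in> carrier G" using t by (rule hdiag_carrier)
  assume "f \<otimes> f \<otimes> f \<noteq> \<one>"
  then have "tr3 (t * t * t) = 0" using hdiag_trace hdiag_mult t by blast
  moreover have tr: "tr3 t = 0" using hdiag_trace[OF t f] .
  moreover have "tr3 (t * t * t) = 3 * (t $ 1 * t $ 2 * t $ 3) + tr3 t * (tr3 t ^ 2 - 3 * (t $ 1 * t $ 2 + t $ 1 * t $ 3 + t $ 2 * t $ 3))"
    by (simp add: tr3_def algebra_simps power2_eq_square)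
  ultimately have "3 * (t $ 1 * t $ 2 * t $ 3) = 0" by simp
  then have zero: "t $ 1 = 0 \<or> t $ 2 = 0 \<or> t $ 3 = 0" by simp
  have "\<exists>n\<in>{1, 2, 3}. \<exists>c. c \<noteq> 0 \<and> t * t = c *s off_axis n"
  proof -
    consider "t $ 1 = 0" "t $ 3 = - t $ 2" | "t $ 2 = 0" "t $ 3 = - t $ 1" | "t $ 3 = 0" "t $ 2 = - t $ 1"
      using zero tr by (auto simp: tr3_def eq_neg_iff_add_eq_0 add.commute)
    then show ?thesis
    proof cases
      case 1
      then have "t $ 2 * t $ 2 \<noteq> 0" using nz by (auto simp: vec3_eq_iff)
      then show ?thesis using 1 by (intro bexI[of _ 1] exI[of _ "t $ 2 * t $ 2"]) (auto simp: vec3_eq_iff)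
    next
      case 2
      then have "t $ 1 * t $ 1 \<noteq> 0" using nz by (auto simp: vec3_eq_iff)
      then show ?thesis using 2 by (intro bexI[of _ 2] exI[of _ "t $ 1 * t $ 1"]) (auto simp: vec3_eq_iff)
    next
      case 3
      then have "t $ 1 * t $ 1 \<noteq> 0" using nz by (auto simp: vec3_eq_iff)
      then show ?thesis using 3 by (intro bexI[of _ 3] exI[of _ "t $ 1 * t $ 1"]) (auto simp: vec3_eq_iff)
    qed
  qed
  then obtain n c where n: "n \<in> {1, 2, 3}" and c: "c \<noteq> 0" "t * t = c *s off_axis n" by blast
  have "off_axis n = (1 / c) *s (t * t)" using c by (simp add: vec3_eq_iff)
  then have h: "hdiag (f \<otimes> f) (off_axis n)"
    using hdiag_scale[OF hdiag_mult[OF t t], of "1 / c"] by simp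
  have "off_axis n * off_axis n = off_axis n" by (simp add: vec3_eq_iff)
  then have "hdiag (f \<otimes> f \<otimes> (f \<otimes> f)) (off_axis n)" using hdiag_mult[OF h h] by simp
  moreover have "off_axis n \<noteq> 0" using n by (auto simp: vec3_eq_iff)
  ultimately have "f \<otimes> f \<otimes> (f \<otimes> f) = f \<otimes> f" using h hdiag_unique by blast
  then have "f \<otimes> f = \<one>" using fc by (metis m_closed l_cancel_one)
  then show False using h n not_hdiag_off_axis by simp
qed

text \<open>
  A nonzero vector \<open>t\<close> for which \<open>t\<close> and \<open>t\<^sup>2\<close> have trace zero is a multiple of \<open>(1, \<zeta>, \<zeta>\<^sup>2)\<close> or of its
  square \<open>(1, \<zeta>\<^sup>2, \<zeta>)\<close>; in the second case replace \<open>t\<close> by \<open>t\<^sup>2\<close> and \<open>f\<close> by \<open>f\<^sup>2\<close>.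
\<close>

lemma hdiag_omega:
  obtains f where "hdiag f omega" "f \<noteq> \<one>" "f \<otimes> f \<otimes> f = \<one>"
proof -
  obtain f t where t: "hdiag f t" and f: "f \<noteq> \<one>" and nz: "t \<noteq> 0" by (rule hdiag_nontrivial)
  have fc: "f \<in> carrier G" using t by (rule hdiag_carrier)
  have f3: "f \<otimes> f \<otimes> f = \<one>" using hdiag_cube[OF t f nz] .
  have f2: "f \<otimes> f \<noteq> \<one>" using f3 f fc by auto
  have tr: "tr3 t = 0" "tr3 (t * t) = 0"
    using hdiag_trace[OF t f] hdiag_trace[OF hdiag_mult[OF t t] f2] by auto
  then have t3: "t $ 3 = - t $ 1 - t $ 2" by (simp add: tr3_def eq_diff_eq eq_neg_iff_add_eq_0 add_ac)
  have "2 * ((t $ 1) ^ 2 + t $ 1 * t $ 2 + (t $ 2) ^ 2) = 0"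
    using tr(2) unfolding tr3_def by (simp add: t3 algebra_simps power2_eq_square)
  then have "(t $ 1) ^ 2 + t $ 1 * t $ 2 + (t $ 2) ^ 2 = 0"
    unfolding mult_eq_0_iff by simp
  then have "t $ 2 = \<zeta> * t $ 1 \<or> t $ 2 = \<zeta> ^ 2 * t $ 1"
    by (rule cube_root_pair)
  then have "t = (t $ 1) *s omega \<or> t = (t $ 1) *s vector [1, \<zeta> ^ 2, \<zeta>]"
  proof
    assume "t $ 2 = \<zeta> * t $ 1"
    then have "t = (t $ 1) *s omega"
      using t3 by (simp add: vec3_eq_iff zeta_square algebra_simps)
    then show ?thesis ..
  next
    assume t2: "t $ 2 = \<zeta> ^ 2 * t $ 1"
    have "t $ 3 = \<zeta> * t $ 1"
      unfolding t3 t2 zeta_square by (simp add: algebra_simps)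
    with t2 have "t = (t $ 1) *s vector [1, \<zeta> ^ 2, \<zeta>]"
      by (simp add: vec3_eq_iff)
    then show ?thesis ..
  qed
  moreover from this have "t $ 1 \<noteq> 0" using nz by auto
  ultimately have "omega = (1 / (t $ 1)) *s t \<or> vector [1, \<zeta> ^ 2, \<zeta>] = (1 / (t $ 1)) *s t"
    by (metis (no_types, lifting) nonzero_divide_eq_eq one_neq_zero vector_smult_assoc vector_smult_lid)
  then consider "hdiag f omega" | "hdiag f (vector [1, \<zeta> ^ 2, \<zeta>])"
    using hdiag_scale[OF t, of "1 / (t $ 1)"] by metis
  then show ?thesis
  proof cases
    case 1
    then show ?thesis using that f f3 by blast
  next
    case 2
    have "\<zeta> ^ 2 * \<zeta> ^ 2 = \<zeta> ^ 3 * \<zeta>" by (simp add: power2_eq_square power3_eq_cube mult.assoc)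
    then have "\<zeta> ^ 2 * \<zeta> ^ 2 = \<zeta>" by (simp add: zeta_cube)
    then have "vector [1, \<zeta> ^ 2, \<zeta>] * vector [1, \<zeta> ^ 2, \<zeta>] = omega"
      by (simp add: vec3_eq_iff power2_eq_square)
    then have "hdiag (f \<otimes> f) omega" using hdiag_mult[OF 2 2] by simp
    moreover have "f \<otimes> f \<otimes> (f \<otimes> f) \<otimes> (f \<otimes> f) = \<one>"
      using f3 fc by (metis m_assoc m_closed r_one)
    ultimately show ?thesis using that f2 by blast
  qed
qed

end

section \<open>Torus automorphisms and Fourier bases\<close>

lemma (in group) ord_eq_3: "x \<in> carrier G \<Longrightarrow> x \<noteq> \<one> \<Longrightarrow> x \<otimes> x \<otimes> x = \<one> \<Longrightarrow> ord x = 3"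
proof -
  assume x: "x \<in> carrier G" "x \<noteq> \<one>" "x \<otimes> x \<otimes> x = \<one>"
  have "x [^] (3::nat) = \<one>" using x by (simp add: numeral_3_eq_3)
  then have "ord x dvd 3" using x pow_eq_id by blast
  moreover have "prime (3::nat)" by simp
  ultimately have "ord x = 1 \<or> ord x = 3" by (simp add: prime_nat_iff)
  then show ?thesis using x ord_eq_1 by blast
qed

lemma (in group) ord_eq_2: "x \<in> carrier G \<Longrightarrow> x \<noteq> \<one> \<Longrightarrow> x \<otimes> x = \<one> \<Longrightarrow> ord x = 2"
proof -
  assume x: "x \<in> carrier G" "x \<noteq> \<one>" "x \<otimes> x = \<one>"
  have "x [^] (2::nat) = \<one>" using x by (simp add: numeral_2_eq_2)
  then have "ord x dvd 2" using x pow_eq_id by blast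
  moreover have "prime (2::nat)" by simp
  ultimately have "ord x = 1 \<or> ord x = 2" by (simp add: prime_nat_iff)
  then show ?thesis using x ord_eq_1 by blast
qed

context char_not_two
begin

definition torus :: "'a ^ 3 \<Rightarrow> 'a ^ 3 \<Rightarrow> 'a qcayley \<Rightarrow> 'a qcayley" where
  "torus a b x = smat (mp x) (mq x) (a * ma x) (b * mb x)"

lemma torus_smat [simp]: "torus a b (smat p q c d) = smat p q (a * c) (b * d)"
  by (simp add: torus_def)

lemma qlinear_torus: "qlinear (torus a b)"
proof -
  have "torus a b (y + z) = torus a b y + torus a b z" "torus a b (c *q y) = c *q torus a b y" for y z and c :: 'a
    by (cases y rule: smat_cases; cases z rule: smat_cases; simp add: smat_ops algebra_simps)+
  then show ?thesis by (simp add: qlinear_iff)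
qed

lemma torus_inverse: "a * b = 1 \<Longrightarrow> torus a b (torus b a x) = x"
proof -
  assume ab: "a * b = 1"
  have "a * (b * c) = a * b * c" "b * (a * c) = a * b * c" for c by (simp_all add: mult_ac)
  then show ?thesis by (cases x rule: smat_cases) (simp add: ab)
qed

lemma cofactors:
  fixes a b :: "'a ^ 3"
  assumes "a * b = 1" "a $ 1 * a $ 2 * a $ 3 = 1"
  shows "a $ 2 * a $ 3 = b $ 1" "a $ 1 * a $ 3 = b $ 2" "a $ 1 * a $ 2 = b $ 3"
proof -
  have ab: "a $ 1 * b $ 1 = 1" "a $ 2 * b $ 2 = 1" "a $ 3 * b $ 3 = 1"
    using assms(1) by (simp_all add: vec3_eq_iff)
  have "a $ 2 * a $ 3 = (a $ 1 * b $ 1) * (a $ 2 * a $ 3)" by (simp add: ab)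
  also have "\<dots> = b $ 1 * (a $ 1 * a $ 2 * a $ 3)" by (simp add: mult_ac)
  finally show "a $ 2 * a $ 3 = b $ 1" by (simp add: assms)
  have "a $ 1 * a $ 3 = (a $ 2 * b $ 2) * (a $ 1 * a $ 3)" by (simp add: ab)
  also have "\<dots> = b $ 2 * (a $ 1 * a $ 2 * a $ 3)" by (simp add: mult_ac)
  finally show "a $ 1 * a $ 3 = b $ 2" by (simp add: assms)
  have "a $ 1 * a $ 2 = (a $ 3 * b $ 3) * (a $ 1 * a $ 2)" by (simp add: ab)
  also have "\<dots> = b $ 3 * (a $ 1 * a $ 2 * a $ 3)" by (simp add: mult_ac)
  finally show "a $ 1 * a $ 2 = b $ 3" by (simp add: assms)
qed

lemma torus_scross:
  fixes a b :: "'a ^ 3"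
  assumes "a * b = 1" "a $ 1 * a $ 2 * a $ 3 = 1"
  shows "scross (a * u) (a * v) = b * scross u v"
  by (simp only: vec3_eq_iff scross_nth vector_mult_component cofactors[OF assms, symmetric])
    (simp add: algebra_simps)

lemma prod_inverse_vec:
  fixes a b :: "'a ^ 3"
  assumes "a * b = 1" "a $ 1 * a $ 2 * a $ 3 = 1"
  shows "b $ 1 * b $ 2 * b $ 3 = 1"
proof -
  have ab: "a $ 1 * b $ 1 = 1" "a $ 2 * b $ 2 = 1" "a $ 3 * b $ 3 = 1"
    using assms(1) by (simp_all add: vec3_eq_iff)
  have "b $ 1 * b $ 2 * b $ 3 = (a $ 1 * a $ 2 * a $ 3) * (b $ 1 * b $ 2 * b $ 3)" by (simp add: assms)
  also have "\<dots> = (a $ 1 * b $ 1) * (a $ 2 * b $ 2) * (a $ 3 * b $ 3)" by (simp add: mult_ac)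
  finally show ?thesis by (simp add: ab)
qed

text \<open>
  The dot product is preserved because \<open>b\<close> is the inverse of \<open>a\<close>. As \<open>a\<close> has norm 1, its inverse is also
  its cofactor vector, so that \<open>(a u) \<times> (a v) = b (u \<times> v)\<close>.
\<close>

lemma is_automorphism_torus:
  assumes ab: "a * b = 1" and a: "a $ 1 * a $ 2 * a $ 3 = 1"
  shows "is_automorphism (torus a b)"
  unfolding is_automorphism_def
proof (intro conjI allI)
  have ba: "b * a = 1" using ab by (simp add: mult.commute)
  have b: "b $ 1 * b $ 2 * b $ 3 = 1" using prod_inverse_vec[OF ab a] .
  show "qlinear (torus a b)" by (rule qlinear_torus)
  show "bij (torus a b)"
    by (rule o_bij[of "torus b a"]) (auto simp: torus_inverse[OF ab] torus_inverse[OF ba])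
  fix x y :: "'a qcayley"
  obtain p q u v where x: "x = smat p q u v" by (rule smat_cases)
  obtain p' q' u' v' where y: "y = smat p' q' u' v'" by (rule smat_cases)
  have "a * u * (b * v') = (a * b) * (u * v')" "b * v * (a * u') = (a * b) * (v * u')"
    by (simp_all add: mult_ac)
  then have tr: "a * u * (b * v') = u * v'" "b * v * (a * u') = v * u'" by (simp_all add: ab)
  show "torus a b (x \<star> y) = torus a b x \<star> torus a b y"
    unfolding x y torus_smat smat_mult smat_inj tr torus_scross[OF ab a] torus_scross[OF ba b]
    by (simp add: vec3_eq_iff algebra_simps)
  show "torus a b (qinvol x) = qinvol (torus a b x)"
    by (simp add: x smat_invol)
qed

end

context incompatible_qcayley
begin

lemma zeta_powers:
  "\<zeta> * \<zeta> = \<zeta> ^ 2" "\<zeta> * \<zeta> ^ 2 = 1" "\<zeta> ^ 2 * \<zeta> = 1" "\<zeta> ^ 2 * \<zeta> ^ 2 = \<zeta>" "\<zeta> ^ 4 = \<zeta>"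
proof -
  show z: "\<zeta> * \<zeta> = \<zeta> ^ 2" by (simp add: power2_eq_square)
  show c: "\<zeta> * \<zeta> ^ 2 = 1" using zeta_cube by (simp add: power2_eq_square power3_eq_cube mult.assoc)
  then show "\<zeta> ^ 2 * \<zeta> = 1" by (simp only: mult.commute)
  have "\<zeta> ^ 2 * \<zeta> ^ 2 = \<zeta> * (\<zeta> * \<zeta> ^ 2)" by (simp add: power2_eq_square mult.assoc)
  then show q: "\<zeta> ^ 2 * \<zeta> ^ 2 = \<zeta>" by (simp only: c mult_1_right)
  show "\<zeta> ^ 4 = \<zeta>" using q by (simp flip: power_add)
qed

text \<open>
  From \<open>T\<^sup>3 - 1 = (T - c) (T\<^sup>2 + c T + c\<^sup>2)\<close> for a cubic root of unity \<open>c\<close>.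
\<close>

lemma omega_relation:
  "omega * omega + (omega $ i) *s omega + (omega $ i) ^ 2 *s 1 = (3 * (omega $ i) ^ 2) *s axis i 1"
  using exhaust_3[of i]
  by (elim disjE)
    (simp_all add: vec3_eq_iff axis_def zeta_powers, simp_all add: zeta_square)

lemma omega_nonzero [simp]: "omega $ i \<noteq> 0"
proof -
  have "\<zeta> \<noteq> 0" using zeta_cube by auto
  then show ?thesis using exhaust_3[of i] by auto
qed

lemma fourier:
  obtains x y z where "(a :: 'a ^ 3) = x *s 1 + y *s omega + z *s (omega * omega)"
proof
  show "a = ((a $ 1 + a $ 2 + a $ 3) / 3) *s 1
    + ((a $ 1 + \<zeta> ^ 2 * a $ 2 + \<zeta> * a $ 3) / 3) *s omega
    + ((a $ 1 + \<zeta> * a $ 2 + \<zeta> ^ 2 * a $ 3) / 3) *s (omega * omega)"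
  proof -
    have "3 *s a = (a $ 1 + a $ 2 + a $ 3) *s 1
      + (a $ 1 + \<zeta> ^ 2 * a $ 2 + \<zeta> * a $ 3) *s omega
      + (a $ 1 + \<zeta> * a $ 2 + \<zeta> ^ 2 * a $ 3) *s (omega * omega)"
    proof -
      have *: "(x + \<zeta> ^ 2 * y + \<zeta> * z) * \<zeta> = \<zeta> * x + y + \<zeta> ^ 2 * z"
        "(x + \<zeta> * y + \<zeta> ^ 2 * z) * \<zeta> = \<zeta> * x + \<zeta> ^ 2 * y + z"
        "(x + \<zeta> * y + \<zeta> ^ 2 * z) * \<zeta> ^ 2 = \<zeta> ^ 2 * x + y + \<zeta> * z"
        "(x + \<zeta> ^ 2 * y + \<zeta> * z) * \<zeta> ^ 2 = \<zeta> ^ 2 * x + \<zeta> * y + z" for x y z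
        by (subst mult.commute, simp only: distrib_left mult.assoc [symmetric] zeta_powers mult_1_left)+
      show ?thesis
        by (simp only: vec3_eq_iff vector_add_component vector_smult_component vector_mult_component
            omega_nth one_index mult_1_right zeta_powers *)
          (simp add: zeta_square algebra_simps)
    qed
    then have "(1 / 3) *s (3 *s a) = (1 / 3) *s ((a $ 1 + a $ 2 + a $ 3) *s 1
      + (a $ 1 + \<zeta> ^ 2 * a $ 2 + \<zeta> * a $ 3) *s omega
      + (a $ 1 + \<zeta> * a $ 2 + \<zeta> ^ 2 * a $ 3) *s (omega * omega))"
      by simp
    then show ?thesis by (simp add: vec3_eq_iff add_divide_distrib)
  qed
qed

lemma span_Fourier_basis:
  assumes "q1 \<in> qc.span S" "qs \<in> qc.span S"
    and u: "\<And>v. v \<in> {1, omega, omega * omega} \<Longrightarrow> smat 0 0 v 0 \<in> qc.span S"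
    and v: "\<And>v. v \<in> {1, omega, omega * omega} \<Longrightarrow> smat 0 0 0 v \<in> qc.span S"
  shows "qc.span S = (UNIV :: 'a qcayley set)"
proof -
  have "x \<in> qc.span S" for x :: "'a qcayley"
  proof -
    obtain p q a b where x: "x = smat p q a b" by (rule smat_cases)
    obtain a1 a2 a3 where a: "a = a1 *s 1 + a2 *s omega + a3 *s (omega * omega)" by (rule fourier)
    obtain b1 b2 b3 where b: "b = b1 *s 1 + b2 *s omega + b3 *s (omega * omega)" by (rule fourier)
    have "x = ((p + q) / 2) *q q1 + ((p - q) / 2) *q qs
      + (a1 *q smat 0 0 1 0 + a2 *q smat 0 0 omega 0 + a3 *q smat 0 0 (omega * omega) 0)
      + (b1 *q smat 0 0 0 1 + b2 *q smat 0 0 0 omega + b3 *q smat 0 0 0 (omega * omega))"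
      unfolding x a b
      by (simp add: q1_smat qs_smat smat_add smat_scale smat_inj add_divide_distrib diff_divide_distrib)
    also have "\<dots> \<in> qc.span S"
      using assms by (intro qc.span_add qc.span_scale) auto
    finally show ?thesis .
  qed
  then show ?thesis by blast
qed

section \<open>The two families of gradings\<close>

context
  fixes f
  assumes omega: "hdiag f omega" and f_neq: "f \<noteq> \<one>" and f_cube: "f \<otimes> f \<otimes> f = \<one>"
begin

lemma f_carrier [simp]: "f \<in> carrier G"
  using omega by (rule hdiag_carrier)

lemma f_square_neq: "f \<otimes> f \<noteq> \<one>"
  using f_cube f_neq by auto

lemma f_shift_neq: "k \<in> carrier G \<Longrightarrow> k \<noteq> f \<otimes> k" "k \<in> carrier G \<Longrightarrow> k \<noteq> f \<otimes> f \<otimes> k"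
  using f_neq f_square_neq by (metis f_carrier l_cancel_one m_closed r_cancel_one')+

text \<open>
  The three terms of the polynomial in \<open>omega\<close> shift the degree \<open>k\<close> to \<open>f\<^sup>2 k\<close>, \<open>f k\<close> and \<open>k\<close>, which are
  different. In particular the component of degree \<open>k\<close> of the value at \<open>w\<close> is \<open>c\<^sup>2 w\<close>.
\<close>

lemma component_omega_relation:
  assumes w: "hom_elt k (smat 0 0 a b)"
  shows "component l (xdiag (omega * omega + c *s omega + c ^ 2 *s 1) (smat 0 0 a b)) =
    (if l = f \<otimes> f \<otimes> k then smat 0 0 (omega * omega * a) (omega * omega * b) else 0)
    + c *q (if l = f \<otimes> k then smat 0 0 (omega * a) (omega * b) else 0)
    + c ^ 2 *q (if l = k then smat 0 0 a b else 0)"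
proof -
  have "xdiag (omega * omega + c *s omega + c ^ 2 *s 1) (smat 0 0 a b) =
    smat 0 0 (omega * omega * a) (omega * omega * b)
    + c *q smat 0 0 (omega * a) (omega * b) + c ^ 2 *q smat 0 0 a b"
    by (simp add: smat_add smat_scale smat_inj vec3_eq_iff algebra_simps)
  moreover have "hom_elt (f \<otimes> f \<otimes> k) (smat 0 0 (omega * omega * a) (omega * omega * b))"
    by (rule hdiag_hom_elt[OF hdiag_mult[OF omega omega] w])
  moreover have "hom_elt (f \<otimes> k) (smat 0 0 (omega * a) (omega * b))"
    by (rule hdiag_hom_elt[OF omega w])
  ultimately show ?thesis
    using w by (simp only: component_add component_scale component_hom_elt)
qed

text \<open>
  If coordinate \<open>i\<close> of \<open>w\<close> vanishes, the polynomial of \<open>omega_relation\<close> annihilates \<open>w\<close>.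
\<close>

lemma U_coordinates_nonzero:
  assumes w: "hom_elt k (smat 0 0 a 0)" and a: "a \<noteq> 0"
  shows "a $ i \<noteq> 0"
proof
  assume "a $ i = 0"
  then have "axis i 1 * a = 0" by (auto simp: vec_eq_iff axis_def)
  then have "xdiag (omega * omega + (omega $ i) *s omega + (omega $ i) ^ 2 *s 1) (smat 0 0 a 0) = 0"
    unfolding omega_relation xdiag_smat zero_smat smat_inj by (simp add: vec_eq_iff)
  then have "component k (xdiag (omega * omega + (omega $ i) *s omega + (omega $ i) ^ 2 *s 1) (smat 0 0 a 0)) = 0"
    using qlinear_0[OF qlinear_component] by simp
  moreover have k: "k \<in> carrier G" using w by simp
  ultimately have "(omega $ i) ^ 2 *q smat 0 0 a 0 = 0"
    using f_shift_neq[OF k] unfolding component_omega_relation[OF w] by simp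
  then show False using a by (simp add: smat_scale zero_smat smat_inj vec_eq_iff)
qed

text \<open>
  The three vectors \<open>w, D w, D\<^sup>2 w\<close> of degrees \<open>k, f k, f\<^sup>2 k\<close> are permuted by \<open>D\<close> up to scalars, so \<open>w\<close> can be
  chosen such that \<open>f k\<close> and \<open>f\<^sup>2 k\<close> differ from \<open>e\<close>; these two degrees are \<open>g\<^sub>1\<close> and \<open>g\<^sub>2\<close>.
\<close>

lemma Gamma33_case:
  assumes h: "hom_elt \<one> qs"
  shows "\<exists>g1\<in>carrier G. \<exists>g2\<in>carrier G. ord g1 = 3 \<and> ord g2 = 3 \<and>
    g1 \<noteq> g2 \<and> g2 \<noteq> inv (g1 \<otimes> g2) \<and> isomorphic_gradings G A (Gamma33 G \<zeta> g1 g2)"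
proof -
  have ep: "hom_elt \<one> e_plus"
    unfolding e_plus_def by (intro hom_elt_scale hom_elt_add hom_elt_one h)
  have U: "homog_map \<one> (\<lambda>x. e_plus \<star> xdiag 1 x)"
    using homog_map_compose[OF homog_map_mult_left[OF ep], of \<one> "xdiag 1"] hdiag_one
    by (simp add: hdiag_def)
  have U_smat: "e_plus \<star> xdiag 1 x = smat 0 0 (ma x) 0" for x
    by (cases x rule: smat_cases) (simp add: e_plus_smat smat_ops)
  obtain k a where w: "hom_elt k (smat 0 0 a 0)" and a: "a \<noteq> 0"
  proof -
    have "smat 0 0 1 0 \<noteq> (0 :: 'a qcayley)" by (simp add: zero_smat smat_inj)
    then obtain k where k: "k \<in> carrier G" "component k (smat 0 0 1 0) \<noteq> 0"
      using component_nonzero_ex by blast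
    have "component k (smat 0 0 1 0) = smat 0 0 (ma (component k (smat 0 0 1 0))) 0"
      using component_homog_map_one[OF U k(1), of "smat 0 0 1 0"] unfolding U_smat smat_sel .
    then show ?thesis
      using that[of k "ma (component k (smat 0 0 1 0))"] k hom_elt_component[OF k(1), of "smat 0 0 1 0"]
      by (metis zero_smat)
  qed
  have cube: "k \<otimes> (k \<otimes> k) = \<one>" if w: "hom_elt k (smat 0 0 a 0)" and a: "a \<noteq> 0" for k a
  proof -
    have "smat 0 0 a 0 \<star> (smat 0 0 a 0 \<star> smat 0 0 a 0) = (6 * (a $ 1 * a $ 2 * a $ 3)) *q e_plus"
      by (simp add: e_plus_smat smat_ops)
    moreover have "(6::'a) = 2 * 3" by simp
    then have "(6::'a) \<noteq> 0" by (simp only: mult_eq_0_iff two_nz three_nz) simp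
    then have "(6 * (a $ 1 * a $ 2 * a $ 3)) *q e_plus \<noteq> 0"
      using U_coordinates_nonzero[OF w a] by (simp add: e_plus_smat smat_scale zero_smat smat_inj)
    ultimately show ?thesis
      using hom_elt_unique hom_elt_mult[OF w hom_elt_mult[OF w w]] hom_elt_scale[OF ep] by metis
  qed
  obtain k a where w: "hom_elt k (smat 0 0 a 0)" and a: "a \<noteq> 0" and fk: "f \<otimes> k \<noteq> \<one>" "f \<otimes> f \<otimes> k \<noteq> \<one>"
  proof -
    have kc: "k \<in> carrier G" using w by simp
    have w1: "hom_elt (f \<otimes> k) (smat 0 0 (omega * a) 0)"
      using hdiag_hom_elt[OF omega w] by simp
    have w2: "hom_elt (f \<otimes> f \<otimes> k) (smat 0 0 (omega * omega * a) 0)"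
      using hdiag_hom_elt[OF hdiag_mult[OF omega omega] w] by simp
    have nz: "omega * a \<noteq> 0" "omega * omega * a \<noteq> 0"
      using a omega_nonzero by (auto simp: vec_eq_iff simp del: omega_nth)
    consider "f \<otimes> k = \<one>" | "f \<otimes> f \<otimes> k = \<one>" | "f \<otimes> k \<noteq> \<one>" "f \<otimes> f \<otimes> k \<noteq> \<one>" by blast
    then show ?thesis
    proof cases
      case 1
      show ?thesis
        by (rule that[OF w1 nz(1)]) (simp_all add: 1 f_neq f_square_neq)
    next
      case 2
      show ?thesis
        by (rule that[OF w2 nz(2)]) (simp_all add: 2 f_neq f_square_neq)
    next
      case 3
      then show ?thesis using that w a by blast
    qed
  qed
  have kc: "k \<in> carrier G" using w by simp
  define N where "N = a $ 1 * a $ 2 * a $ 3"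
  have N: "N \<noteq> 0" using U_coordinates_nonzero[OF w a] by (simp add: N_def)
  \<comment> \<open>scaling by \<open>c\<close> makes the norm of \<open>w\<close> equal to 1\<close>
  obtain c where c: "c ^ 3 = 1 / N" using nth_root_exists[of 3 "1 / N"] by auto
  define a' where "a' = c *s a"
  have w': "hom_elt k (smat 0 0 a' 0)"
    using hom_elt_scale[OF w, of c] by (simp add: smat_scale a'_def)
  have "a' $ 1 * a' $ 2 * a' $ 3 = c ^ 3 * N"
    by (simp add: a'_def N_def power3_eq_cube)
  then have a': "a' $ 1 * a' $ 2 * a' $ 3 = 1" using c N by simp
  \<comment> \<open>for norm 1 the cofactor vector is the inverse of \<open>a'\<close>; it is half of \<open>w w\<close>, hence homogeneous\<close>
  define b where "b = (1 / 2) *s scross a' a'"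
  have b_nth: "b $ 1 = a' $ 2 * a' $ 3" "b $ 2 = a' $ 1 * a' $ 3" "b $ 3 = a' $ 1 * a' $ 2"
    by (simp_all add: b_def mult.commute)
  have ab: "a' * b = 1"
    using a' by (simp add: vec3_eq_iff b_nth mult_ac)
  have v': "hom_elt (k \<otimes> k) (smat 0 0 0 b)"
    using hom_elt_scale[OF hom_elt_mult[OF w' w'], of "1 / 2"]
    by (simp add: smat_mult smat_scale tr3_def b_def)
  define g1 where "g1 = f \<otimes> k"
  define g2 where "g2 = f \<otimes> f \<otimes> k"
  have k3: "k \<otimes> (k \<otimes> k) = \<one>" using cube[OF w a] .
  have f3: "f \<otimes> (f \<otimes> f) = \<one>" using f_cube by (simp add: m_assoc)
  have f3l: "f \<otimes> (f \<otimes> (f \<otimes> x)) = x" if "x \<in> carrier G" for x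
    using f_cube that by (simp flip: m_assoc)
  have k3l: "k \<otimes> (k \<otimes> (k \<otimes> x)) = x" if "x \<in> carrier G" for x
    using k3 kc that by (simp flip: m_assoc)
  have gc [simp]: "g1 \<in> carrier G" "g2 \<in> carrier G" by (simp_all add: g1_def g2_def kc)
  have ord: "ord g1 = 3" "ord g2 = 3"
    by (rule ord_eq_3; use fk kc in \<open>simp add: g1_def g2_def m_ac f3 f3l k3 k3l\<close>)+
  have inv12: "inv (g1 \<otimes> g2) = k"
    by (rule inv_equality) (simp_all add: g1_def g2_def kc m_ac f3 f3l k3 k3l)
  have prod12: "g1 \<otimes> g2 = k \<otimes> k"
    by (simp add: g1_def g2_def kc m_ac f3 f3l k3 k3l)
  have inv1: "inv g1 = f \<otimes> f \<otimes> (k \<otimes> k)"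
    by (rule inv_equality) (simp_all add: g1_def kc m_ac f3 f3l k3 k3l)
  have inv2: "inv g2 = f \<otimes> (k \<otimes> k)"
    by (rule inv_equality) (simp_all add: g2_def kc m_ac f3 f3l k3 k3l)
  have neq: "g1 \<noteq> g2"
    using f_shift_neq(1)[OF kc] kc by (auto simp: g1_def g2_def m_assoc)
  have neq': "g2 \<noteq> inv (g1 \<otimes> g2)"
    unfolding inv12 using f_shift_neq(2)[OF kc] by (simp add: g2_def not_sym)
  have om2: "vector [1, \<zeta> ^ 2, \<zeta>] = omega * omega"
    by (simp add: vec3_eq_iff zeta_powers)
  have one3: "vector [1, 1, 1] = (1 :: 'a ^ 3)" by (simp add: vec3_eq_iff)
  have plus: "e_plus \<star> smat 0 0 v v = smat 0 0 v 0" and minus: "e_minus \<star> smat 0 0 v v = smat 0 0 0 v"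
    for v :: "'a ^ 3"
    by (simp_all add: e_plus_smat e_minus_smat smat_ops)
  note basis = xcomb_smat omega_def [symmetric] om2 one3 plus minus
  let ?D = "{(q1, \<one>), (qs, \<one>), (smat 0 0 omega 0, g1), (smat 0 0 (omega * omega) 0, g2),
    (smat 0 0 1 0, inv (g1 \<otimes> g2)), (smat 0 0 0 (omega * omega), inv g1),
    (smat 0 0 0 omega, inv g2), (smat 0 0 0 1, g1 \<otimes> g2)}"
  have "Gamma33 G \<zeta> g1 g2 = graded_by_basis ?D"
    unfolding Gamma33_def basis ..
  moreover have "isomorphic_gradings G A (graded_by_basis ?D)"
  proof (rule isomorphic_by_basis[where \<phi> = "torus b a'" and \<psi> = "torus a' b"])
    have ba: "b * a' = 1" using ab by (simp add: mult.commute)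
    show "is_automorphism (torus b a')"
      by (rule is_automorphism_torus[OF ba prod_inverse_vec[OF ab a']])
    show "torus b a' (torus a' b x) = x" "torus a' b (torus b a' x) = x" for x
      by (rule torus_inverse[OF ba], rule torus_inverse[OF ab])
    show "qlinear (torus a' b)" by (rule qlinear_torus)
    have q: "torus a' b q1 = q1" "torus a' b qs = qs"
      by (simp_all add: q1_smat qs_smat)
    have "hom_elt g1 (smat 0 0 (a' * omega) 0)" "hom_elt g2 (smat 0 0 (a' * (omega * omega)) 0)"
      using hdiag_hom_elt[OF omega w'] hdiag_hom_elt[OF hdiag_mult[OF omega omega] w']
      by (simp_all add: g1_def g2_def mult.commute)
    moreover have "hom_elt (inv g2) (smat 0 0 0 (b * omega))" "hom_elt (inv g1) (smat 0 0 0 (b * (omega * omega)))"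
      using hdiag_hom_elt[OF omega v'] hdiag_hom_elt[OF hdiag_mult[OF omega omega] v']
      by (simp_all add: inv1 inv2 mult.commute)
    ultimately show "hom_elt g (torus a' b x)" if "(x, g) \<in> ?D" for x g
      using that w' v' h hom_elt_one by (auto simp: q inv12 [unfolded prod12] prod12)
    show "qc.span (fst ` ?D) = UNIV"
      by (rule span_Fourier_basis; rule qc.span_base; auto)
  qed
  ultimately have "isomorphic_gradings G A (Gamma33 G \<zeta> g1 g2)" by simp
  then show ?thesis using gc ord neq neq' by blast
qed

text \<open>
  If a coordinate of \<open>a\<close> or of \<open>b\<close> vanishes, the polynomial of \<open>omega_relation\<close> maps \<open>w\<close> to an
  eigenvector \<open>v\<close> of left multiplication by \<open>s\<close>. The components of \<open>v\<close> have degrees \<open>f\<^sup>2 k, f k, k\<close>, those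
  of \<open>s v\<close> are shifted by \<open>h\<close>, which is not a power of \<open>f\<close>; so the component of degree \<open>k\<close> of \<open>v\<close>, a
  nonzero multiple of \<open>w\<close>, is zero.
\<close>

lemma coordinates_nonzero:
  assumes h: "hom_elt h qs" "h \<noteq> \<one>" "h \<otimes> h = \<one>"
    and w: "hom_elt k (smat 0 0 a b)" and nz: "smat 0 0 a b \<noteq> 0"
  shows "a $ i \<noteq> 0 \<and> b $ i \<noteq> 0"
proof (rule ccontr)
  let ?w = "smat 0 0 a b"
  let ?R = "omega * omega + (omega $ i) *s omega + (omega $ i) ^ 2 *s 1"
  define v where "v = xdiag ?R ?w"
  assume "\<not> (a $ i \<noteq> 0 \<and> b $ i \<noteq> 0)"
  then have ab: "a $ i = 0 \<or> b $ i = 0" by blast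
  \<comment> \<open>the two off-diagonal vectors of \<open>v\<close>, at least one of which is zero\<close>
  define c d where "c = axis i (3 * (omega $ i) ^ 2) * a" and "d = axis i (3 * (omega $ i) ^ 2) * b"
  have cd: "c = 0 \<or> d = 0"
    using ab by (auto simp: c_def d_def vec_eq_iff axis_def)
  have v: "v = smat 0 0 c d"
    unfolding v_def omega_relation xdiag_smat smat_inj c_def d_def by (simp add: vec_eq_iff axis_def)
  from cd have "\<exists>\<sigma>. v + \<sigma> *q (qs \<star> v) = 0"
  proof
    assume "c = 0"
    then have "v + 1 *q (qs \<star> v) = 0"
      by (simp add: v qs_mult_diagonal smat_add smat_scale zero_smat)
    then show ?thesis by blast
  next
    assume "d = 0"
    then have "v + (- 1) *q (qs \<star> v) = 0"
      by (simp add: v qs_mult_diagonal smat_add smat_scale zero_smat smat_inj vec_eq_iff)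
    then show ?thesis by blast
  qed
  then obtain \<sigma> where \<sigma>: "v + \<sigma> *q (qs \<star> v) = 0" by blast
  have c: "k \<in> carrier G" "h \<in> carrier G" using w h by auto
  have hf: "h \<noteq> f" "h \<noteq> f \<otimes> f"
    using h(3) f_cube f_square_neq f_neq by (auto simp: m_assoc)
  have hk: "h \<otimes> k \<noteq> k" "h \<otimes> k \<noteq> f \<otimes> k" "h \<otimes> k \<noteq> f \<otimes> f \<otimes> k"
    using c h(2) hf by simp_all
  have "component (h \<otimes> (h \<otimes> k)) (qs \<star> v) = qs \<star> component (h \<otimes> k) v"
    using c by (intro component_homog_map homog_map_mult_left h) simp
  also have "component (h \<otimes> k) v = 0"
    unfolding v_def component_omega_relation[OF w] using hk by simp
  also have "qs \<star> (0 :: 'a qcayley) = 0" by (rule qlinear_0[OF qlinear_mult_left])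
  also have "h \<otimes> (h \<otimes> k) = k" using c h(3) by (simp flip: m_assoc)
  finally have "component k (v + \<sigma> *q (qs \<star> v)) = component k v"
    by (simp add: component_add component_scale)
  then have "component k v = 0" using \<sigma> qlinear_0[OF qlinear_component] by simp
  then have "(omega $ i) ^ 2 *q ?w = 0"
    unfolding v_def component_omega_relation[OF w] using f_shift_neq[OF c(1)] by simp
  then show False using nz by (simp add: smat_scale zero_smat smat_inj vec_eq_iff)
qed

text \<open>
  Start with any homogeneous \<open>w \<noteq> 0\<close> of \<open>W\<close>, of degree \<open>k\<close>. The traces of the diagonal operators of the
  pairs \<open>(D\<^sup>j w, w)\<close> for \<open>j = 0, 1, 2\<close> are twice the Fourier coefficients of the vector \<open>a b \<noteq> 0\<close>, so
  \<open>f\<^sup>j k\<^sup>2 = e\<close> for some \<open>j\<close>. As \<open>f\<close> has odd order, multiplying \<open>w\<close> by a power of \<open>D\<close> gives \<open>k\<^sup>2 = e\<close>. Then the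
  \<open>K\<close>-part of \<open>w (w w)\<close> is nonzero of degree \<open>k\<^sup>3 = k\<close>, so \<open>k\<close> is \<open>e\<close> or \<open>h\<close>; in the second case take \<open>s w\<close>.
\<close>

lemma W_identity_component:
  assumes h: "hom_elt h qs" "h \<noteq> \<one>" "h \<otimes> h = \<one>"
  obtains a b where "hom_elt \<one> (smat 0 0 a b)" "smat 0 0 a b \<noteq> 0"
proof -
  have hc: "h \<in> carrier G" using h by simp
  have f3: "f \<otimes> (f \<otimes> f) = \<one>" using f_cube by (simp add: m_assoc)
  have f3l: "f \<otimes> (f \<otimes> (f \<otimes> x)) = x" if "x \<in> carrier G" for x
    using f_cube that by (simp flip: m_assoc)
  obtain k a b where w: "hom_elt k (smat 0 0 a b)" and nz: "smat 0 0 a b \<noteq> 0"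
  proof -
    have "smat 0 0 1 1 \<noteq> (0 :: 'a qcayley)" by (simp add: zero_smat smat_inj)
    then obtain k where k: "k \<in> carrier G" "component k (smat 0 0 1 1) \<noteq> 0"
      using component_nonzero_ex by blast
    obtain a b where "component k (smat 0 0 1 1) = smat 0 0 a b" by (rule component_diagonal)
    then show ?thesis using that k hom_elt_component[OF k(1)] by metis
  qed
  obtain k a b where w: "hom_elt k (smat 0 0 a b)" and nz: "smat 0 0 a b \<noteq> 0" and kk: "k \<otimes> k = \<one>"
  proof -
    have kc: "k \<in> carrier G" using w by simp
    have coord: "a $ i \<noteq> 0 \<and> b $ i \<noteq> 0" for i using coordinates_nonzero[OF h w nz] .
    have omega_nz: "omega * a \<noteq> 0" "omega * omega * a \<noteq> 0"
      using coord omega_nonzero by (auto simp: vec_eq_iff simp del: omega_nth)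
    have ft: "\<exists>t g. (t, g) \<in> {(1, \<one>), (omega, f), (omega * omega, f \<otimes> f)} \<and> tr3 (t * a * b + t * b * a) \<noteq> 0"
    proof (rule ccontr)
      assume "\<not> ?thesis"
      then have T: "tr3 (t * a * b + t * b * a) = 0" if "t \<in> {1, omega, omega * omega}" for t
        using that by blast
      obtain x y z where v: "vector [1, 0, 0] = x *s 1 + y *s omega + z *s (omega * omega)" by (rule fourier)
      have "2 * (a $ 1 * b $ 1) = tr3 (vector [1, 0, 0] * a * b + vector [1, 0, 0] * b * a)"
        by (simp add: tr3_def mult.commute)
      also have "\<dots> = x * tr3 (1 * a * b + 1 * b * a) + y * tr3 (omega * a * b + omega * b * a)
          + z * tr3 (omega * omega * a * b + omega * omega * b * a)"
        unfolding v by (simp add: tr3_def algebra_simps)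
      also have "\<dots> = 0"
        by (subst (1 2 3) T) simp_all
      finally show False using coord[of 1] by simp
    qed
    then obtain t g where tg: "(t, g) \<in> {(1, \<one>), (omega, f), (omega * omega, f \<otimes> f)}"
      and tr: "tr3 (t * a * b + t * b * a) \<noteq> 0" by blast
    have "hdiag g t" using tg hdiag_one omega hdiag_mult[OF omega omega] by auto
    then have g: "g \<otimes> k \<otimes> k = \<one>"
      using degree_of_trace[OF hdiag_hom_elt[OF _ w] w tr] by blast
    consider "g = \<one>" | "g = f" | "g = f \<otimes> f" using tg by blast
    then show ?thesis
    proof cases
      case 1
      then show ?thesis using that[OF w nz] g kc by simp
    next
      case 2
      have "f \<otimes> f \<otimes> k \<otimes> (f \<otimes> f \<otimes> k) = (f \<otimes> f \<otimes> f) \<otimes> (f \<otimes> k \<otimes> k)" using kc by (simp add: m_ac)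
      also have "\<dots> = \<one>" using f_cube g 2 by simp
      finally show ?thesis
        using that[OF hdiag_hom_elt[OF hdiag_mult[OF omega omega] w]] omega_nz
        by (simp add: zero_smat smat_inj)
    next
      case 3
      have "f \<otimes> k \<otimes> (f \<otimes> k) = f \<otimes> f \<otimes> k \<otimes> k" using kc by (simp add: m_ac)
      also have "\<dots> = \<one>" using g 3 by simp
      finally show ?thesis
        using that[OF hdiag_hom_elt[OF omega w]] omega_nz
        by (simp add: zero_smat smat_inj)
    qed
  qed
  have kc: "k \<in> carrier G" using w by simp
  have coord: "a $ i \<noteq> 0 \<and> b $ i \<noteq> 0" for i using coordinates_nonzero[OF h w nz] .
  define m n where "m = 6 * (a $ 1 * a $ 2 * a $ 3)" and "n = 6 * (b $ 1 * b $ 2 * b $ 3)"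
  let ?w = "smat 0 0 a b"
  have "hom_elt (k \<otimes> (k \<otimes> k)) (K_part (?w \<star> xdiag 1 (?w \<star> ?w)))"
    using hdiag_one by (intro hom_elt_K_part hom_elt_mult w homog_map_one_hom_elt[of "xdiag 1"]) (simp add: hdiag_def)
  moreover have "K_part (?w \<star> xdiag 1 (?w \<star> ?w)) = smat m n 0 0"
    by (simp add: smat_ops m_def n_def)
  ultimately have mn: "hom_elt k (smat m n 0 0)" using kk kc by simp
  have "(6::'a) = 2 * 3" by simp
  then have "(6::'a) \<noteq> 0" by (simp only: mult_eq_0_iff two_nz three_nz) simp
  then have "m \<noteq> 0" using coord by (simp add: m_def)
  have "k = \<one> \<or> k = h"
  proof (rule ccontr)
    assume "\<not> ?thesis"
    moreover have "smat m n 0 0 = ((m + n) / 2) *q q1 + ((m - n) / 2) *q qs"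
      by (simp add: q1_smat qs_smat smat_add smat_scale smat_inj add_divide_distrib diff_divide_distrib)
    ultimately have "component k (smat m n 0 0) = 0"
      using component_hom_elt[OF hom_elt_one] component_hom_elt[OF h(1)]
      by (simp add: component_add component_scale)
    then show False
      using component_hom_elt[OF mn] \<open>m \<noteq> 0\<close> by (simp add: zero_smat smat_inj)
  qed
  then show ?thesis
  proof
    assume "k = \<one>"
    then show ?thesis using that w nz by blast
  next
    assume "k = h"
    have "qs \<star> ?w = smat 0 0 a (- b)" by (simp add: qs_smat smat_ops)
    then have "hom_elt \<one> (smat 0 0 a (- b))"
      using hom_elt_mult[OF h(1) w] h(3) \<open>k = h\<close> by simp
    then show ?thesis using that[of a "- b"] nz by (simp add: zero_smat smat_inj)
  qed
qed

text \<open>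
  The difference of a homogeneous element of \<open>W\<close> of degree \<open>e\<close> and a suitable multiple of \<open>w\<close> has a
  vanishing coordinate, so it is zero. Applied to the \<open>W\<close>-part of \<open>w w\<close>, this yields after scaling
  \<open>u\<^sub>2 u\<^sub>3 = v\<^sub>1\<close>, \<open>v\<^sub>2 v\<^sub>3 = u\<^sub>1\<close> and so on. All \<open>u\<^sub>i v\<^sub>i\<close> are then equal to the norm \<open>P\<close> of \<open>u\<close> and to the
  norm of \<open>v\<close>, so \<open>P\<^sup>2 = P\<^sup>3\<close> and \<open>P = 1\<close>.
\<close>

lemma Gamma23_case:
  assumes h: "hom_elt h qs" "h \<noteq> \<one>" "h \<otimes> h = \<one>"
  shows "\<exists>h\<in>carrier G. \<exists>g\<in>carrier G. ord h = 2 \<and> ord g = 3 \<and>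
    isomorphic_gradings G A (Gamma23 G \<zeta> h g)"
proof -
  have hc: "h \<in> carrier G" using h by simp
  obtain a b where w: "hom_elt \<one> (smat 0 0 a b)" and nz: "smat 0 0 a b \<noteq> 0"
    by (rule W_identity_component[OF h])
  have coord: "a $ i \<noteq> 0" "b $ i \<noteq> 0" for i using coordinates_nonzero[OF h w nz, of i] by auto
  have sq: "hom_elt \<one> (smat 0 0 (scross b b) (scross a a))"
  proof -
    have "hom_elt \<one> (xdiag 1 (smat 0 0 a b \<star> smat 0 0 a b))"
      using hdiag_one hom_elt_mult[OF w w]
      by (intro homog_map_one_hom_elt[of "xdiag 1"]) (simp_all add: hdiag_def)
    then show ?thesis by (simp add: smat_mult)
  qed
  define l where "l = scross b b $ 1 / a $ 1"
  have sq_w: "scross b b = l *s a" "scross a a = l *s b"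
  proof -
    have d: "hom_elt \<one> (smat 0 0 (scross b b - l *s a) (scross a a - l *s b))"
      using hom_elt_diff[OF sq hom_elt_scale[OF w, of l]] by (simp add: smat_scale smat_diff)
    have "(scross b b - l *s a) $ 1 = 0" using coord(1)[of 1] unfolding l_def by (simp del: scross_nth)
    then have "smat 0 0 (scross b b - l *s a) (scross a a - l *s b) = 0"
      using coordinates_nonzero[OF h d, of 1] by blast
    then show "scross b b = l *s a" "scross a a = l *s b" by (simp_all add: zero_smat smat_inj)
  qed
  have "2 * (b $ 2 * b $ 3) = l * a $ 1"
    using arg_cong[OF sq_w(1), of "\<lambda>v. v $ 1"] by simp
  then have l: "l \<noteq> 0" using coord by auto
  \<comment> \<open>the scaling that turns \<open>w * w = l w\<close> into \<open>w * w = 2 w\<close>\<close>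
  define u v where "u = (2 / l) *s a" and "v = (2 / l) *s b"
  have uv: "hom_elt \<one> (smat 0 0 u v)"
    using hom_elt_scale[OF w, of "2 / l"] by (simp add: smat_scale u_def v_def)
  have prods: "u $ 2 * u $ 3 = v $ 1" "u $ 1 * u $ 3 = v $ 2" "u $ 1 * u $ 2 = v $ 3"
    "v $ 2 * v $ 3 = u $ 1" "v $ 1 * v $ 3 = u $ 2" "v $ 1 * v $ 2 = u $ 3"
  proof -
    have sc: "scross (c *s x) (c *s x) = c ^ 2 *s scross x x" for c and x :: "'a ^ 3"
      by (simp add: vec3_eq_iff power2_eq_square algebra_simps)
    have "(2 / l) ^ 2 * l = 2 * (2 / l)" using l by (simp add: power2_eq_square)
    then have S: "scross u u = 2 *s v" "scross v v = 2 *s u"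
      by (simp_all only: u_def v_def sc sq_w vector_smult_assoc)
    have half: "x * y = z" if "x * y + y * x = 2 * z" for x y z :: 'a
    proof -
      have "2 * (x * y) = 2 * z" using that by (simp add: mult_2 mult.commute)
      then show ?thesis by simp
    qed
    have comps: "x $ 2 * x $ 3 = y $ 1" "x $ 1 * x $ 3 = y $ 2" "x $ 1 * x $ 2 = y $ 3"
      if "scross x x = 2 *s y" for x y :: "'a ^ 3"
      using that by (auto simp only: vec3_eq_iff scross_nth vector_smult_component intro: half)
    show "u $ 2 * u $ 3 = v $ 1" "u $ 1 * u $ 3 = v $ 2" "u $ 1 * u $ 2 = v $ 3"
      "v $ 2 * v $ 3 = u $ 1" "v $ 1 * v $ 3 = u $ 2" "v $ 1 * v $ 2 = u $ 3"
      by (rule comps[OF S(1)] comps[OF S(2)])+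
  qed
  have uv_nz: "u $ i \<noteq> 0" "v $ i \<noteq> 0" for i using coord l by (auto simp: u_def v_def)
  define P where "P = u $ 1 * u $ 2 * u $ 3"
  have P: "u $ 1 * v $ 1 = P" "u $ 2 * v $ 2 = P" "u $ 3 * v $ 3 = P"
    unfolding prods(1-3) [symmetric] P_def by (simp_all add: mult_ac)
  \<comment> \<open>the product of the norms of \<open>u\<close> and \<open>v\<close>, evaluated in two ways\<close>
  have "P * P = P * P * P"
  proof -
    have "v $ 1 * v $ 2 * v $ 3 = v $ 1 * (v $ 2 * v $ 3)" by (simp add: mult.assoc)
    also have "\<dots> = u $ 1 * v $ 1" unfolding prods(4) by (rule mult.commute)
    finally have "P * P = (u $ 1 * u $ 2 * u $ 3) * (v $ 1 * v $ 2 * v $ 3)"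
      by (simp only: P P_def [symmetric])
    also have "\<dots> = (u $ 1 * v $ 1) * (u $ 2 * v $ 2) * (u $ 3 * v $ 3)" by (simp add: mult_ac)
    finally show ?thesis by (simp only: P)
  qed
  moreover have "P \<noteq> 0" using uv_nz by (simp add: P_def)
  ultimately have P1: "P = 1" by simp
  have ab: "u * v = 1" using P P1 by (simp add: vec3_eq_iff)
  have u: "u $ 1 * u $ 2 * u $ 3 = 1" using P1 by (simp add: P_def)
  have ord: "ord h = 2" "ord f = 3"
    using ord_eq_2[OF hc h(2,3)] ord_eq_3[OF f_carrier f_neq f_cube] .
  have om2: "vector [1, \<zeta> ^ 2, \<zeta>] = omega * omega"
    by (simp add: vec3_eq_iff zeta_powers)
  have one3: "vector [1, 1, 1] = (1 :: 'a ^ 3)" by (simp add: vec3_eq_iff)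
  have s: "qs \<star> smat 0 0 v v = smat 0 0 v (- v)" for v :: "'a ^ 3"
    by (simp add: qs_smat smat_ops)
  have f2: "f [^] (2::nat) = f \<otimes> f" by (simp add: numeral_2_eq_2)
  note basis = xcomb_smat omega_def [symmetric] om2 one3 s f2
  let ?D = "{(q1, \<one>), (qs, h), (smat 0 0 omega omega, f), (smat 0 0 (omega * omega) (omega * omega), f \<otimes> f),
    (smat 0 0 1 1, \<one>), (smat 0 0 omega (- omega), h \<otimes> f),
    (smat 0 0 (omega * omega) (- (omega * omega)), h \<otimes> (f \<otimes> f)), (smat 0 0 1 (- 1), h)}"
  have "Gamma23 G \<zeta> h f = graded_by_basis ?D"
    unfolding Gamma23_def basis ..
  moreover have "isomorphic_gradings G A (graded_by_basis ?D)"
  proof (rule isomorphic_by_basis[where \<phi> = "torus v u" and \<psi> = "torus u v"])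
    have ba: "v * u = 1" using ab by (simp add: mult.commute)
    show "is_automorphism (torus v u)"
      by (rule is_automorphism_torus[OF ba prod_inverse_vec[OF ab u]])
    show "torus v u (torus u v x) = x" "torus u v (torus v u x) = x" for x
      by (rule torus_inverse[OF ba], rule torus_inverse[OF ab])
    show "qlinear (torus u v)" by (rule qlinear_torus)
    have q: "torus u v q1 = q1" "torus u v qs = qs"
      by (simp_all add: q1_smat qs_smat)
    have om: "hom_elt f (smat 0 0 (u * omega) (v * omega))"
      "hom_elt (f \<otimes> f) (smat 0 0 (u * (omega * omega)) (v * (omega * omega)))"
      using hdiag_hom_elt[OF omega uv] hdiag_hom_elt[OF hdiag_mult[OF omega omega] uv]
      by (simp_all add: mult.commute)
    have shift: "hom_elt (h \<otimes> g) (smat 0 0 c (- d))" if "hom_elt g (smat 0 0 c d)" for g c d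
      using hom_elt_mult[OF h(1) that] by (simp add: qs_smat smat_ops)
    show "hom_elt g (torus u v x)" if "(x, g) \<in> ?D" for x g
      using that uv h(1) hom_elt_one om shift[OF om(1)] shift[OF om(2)] shift[OF uv] hc
      by (auto simp: q)
    let ?S = "fst ` ?D"
    show "qc.span ?S = UNIV"
    proof (rule span_Fourier_basis)
      show "q1 \<in> qc.span ?S" "qs \<in> qc.span ?S" by (rule qc.span_base; auto)+
      fix v :: "'a ^ 3"
      assume v: "v \<in> {1, omega, omega * omega}"
      have 1: "smat 0 0 v v \<in> qc.span ?S" by (rule qc.span_base) (use v in auto)
      have 2: "smat 0 0 v (- v) \<in> qc.span ?S" by (rule qc.span_base) (use v in auto)
      have "smat 0 0 v 0 = (1 / 2) *q (smat 0 0 v v + smat 0 0 v (- v))"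
        "smat 0 0 0 v = (1 / 2) *q (smat 0 0 v v - smat 0 0 v (- v))"
        by (simp_all add: smat_add smat_diff smat_scale smat_inj vec3_eq_iff)
      then show "smat 0 0 v 0 \<in> qc.span ?S" "smat 0 0 0 v \<in> qc.span ?S"
        using 1 2 by (simp_all only: qc.span_scale qc.span_add qc.span_diff)
    qed
  qed
  ultimately have "isomorphic_gradings G A (Gamma23 G \<zeta> h f)" by simp
  then show ?thesis using hc ord f_carrier by blast
qed

end

theorem classification:
  "(\<exists>g1\<in>carrier G. \<exists>g2\<in>carrier G. ord g1 = 3 \<and> ord g2 = 3 \<and>
      g1 \<noteq> g2 \<and> g2 \<noteq> inv (g1 \<otimes> g2) \<and> isomorphic_gradings G A (Gamma33 G \<zeta> g1 g2)) \<or>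
   (\<exists>h\<in>carrier G. \<exists>g\<in>carrier G. ord h = 2 \<and> ord g = 3 \<and>
      isomorphic_gradings G A (Gamma23 G \<zeta> h g))"
proof -
  obtain f where f: "hdiag f omega" "f \<noteq> \<one>" "f \<otimes> f \<otimes> f = \<one>" by (rule hdiag_omega)
  obtain h where h: "hom_elt h qs" "h \<otimes> h = \<one>" by (rule hom_elt_s)
  show ?thesis
  proof (cases "h = \<one>")
    case True
    then show ?thesis using Gamma33_case[OF f] h by blast
  next
    case False
    then show ?thesis using Gamma23_case[OF f h(1) False h(2)] by blast
  qed
qed

end

theorem proposition4p10:
  fixes G :: "('g, 'm) monoid_scheme"
    and \<zeta> :: "'a :: alg_closed_field"
    and A :: "'g \<Rightarrow> 'a qcayley set"
  assumes "CHAR('a) \<notin> {2, 3, 5}"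
    and "primitive_root_of_unity 3 \<zeta>"
    and "comm_group G"
    and "is_grading G A"
    and "\<forall>i\<in>{1, 2, 3}. \<not> compatible_gradings G (integer_mod_group 2) A (GammaS i)"
  shows "(\<exists>g1\<in>carrier G. \<exists>g2\<in>carrier G.
            group.ord G g1 = 3 \<and> group.ord G g2 = 3 \<and>
            g1 \<noteq> g2 \<and> g2 \<noteq> inv\<^bsub>G\<^esub> (g1 \<otimes>\<^bsub>G\<^esub> g2) \<and>
            isomorphic_gradings G A (Gamma33 G \<zeta> g1 g2)) \<or>
         (\<exists>h\<in>carrier G. \<exists>g\<in>carrier G.
            group.ord G h = 2 \<and> group.ord G g = 3 \<and>
            isomorphic_gradings G A (Gamma23 G \<zeta> h g))"
proof -
  have prime_nz: "of_nat p \<noteq> (0 :: 'a)" if "prime p" "CHAR('a) \<noteq> p" for p :: nat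
  proof
    assume "of_nat p = (0 :: 'a)"
    then have "CHAR('a) dvd p" by (simp add: of_nat_eq_0_iff_char_dvd)
    then have "CHAR('a) = 1" using that by (auto simp: prime_nat_iff)
    then show False by simp
  qed
  have two: "(2 :: 'a) \<noteq> 0" using prime_nz[of 2] assms(1) by auto
  have three: "(3 :: 'a) \<noteq> 0" using prime_nz[of 3] assms(1) by auto
  have z: "\<zeta> ^ 3 = 1" "\<zeta> \<noteq> 1"
    using assms(2) power_one_right[of \<zeta>] unfolding primitive_root_of_unity_def
    by (auto dest: spec[of _ 1])
  have "(\<zeta> - 1) * (1 + \<zeta> + \<zeta> ^ 2) = \<zeta> ^ 3 - 1"
    by (simp add: algebra_simps power2_eq_square power3_eq_cube)
  then have zeta: "1 + \<zeta> + \<zeta> ^ 2 = 0" using z by simp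
  interpret comm_group G by fact
  interpret incompatible_qcayley G A \<zeta>
    using assms two three zeta by unfold_locales auto
  show ?thesis by (rule classification)
qed

end
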